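(* Let $M$ be a properly immersed translator in $\mathbb{H}^2\times\mathbb{R}$ with compact boundary. Suppose that its positive horizontal asymptotic boundary $\partial_\infty^+M$ (respectively, its negative horizontal asymptotic boundary $\partial_\infty^-M$) is a proper family of disjoint immersed continuous curves, and let $\alpha$ be a connected component of $\partial_\infty^+M$ (respectively, of $\partial_\infty^-M$) so that $M\cup\alpha$ is a continuous surface with boundary. Then $\alpha$ is a complete geodesic in $\mathbb{H}^2\times\{+\infty\}$ (respectively, in $\mathbb{H}^2\times\{-\infty\}$), where $\mathbb{H}^2\times\{\pm\infty\}$ is identified with $\mathbb{H}^2$.
   Context: Translators. $\mathbb{H}^2$ is the hyperbolic plane with ideal boundary $\partial_\infty\mathbb{H}^2$, and $\mathbb{H}^2\times\mathbb{R}$ carries the product metric; $\partial_h$ is the unit coordinate vector field of the factor $\mathbb{R}$. A translator is an immersed surface $M$ (here possibly with boundary $\partial M$) in $\mathbb{H}^2\times\mathbb{R}$ satisfying $H=\langle N,\partial_h\rangle$, where $N$ is the unit normal and $H$ the mean curvature with respect to $N$, i.e. the mean curvature vector (trace of the second fundamental form) is $\vec H=HN$. Asymptotic boundary. The boundary at infinity of $\mathbb{H}^2\times\mathbb{R}$ is $\partial_\infty(\mathbb{H}^2\times\mathbb{R})=[\partial_\infty\mathbb{H}^2\times\mathbb{R}]\cup[\mathbb{H}^2\times\{\pm\infty\}]\cup[\partial_\infty\mathbb{H}^2\times\{\pm\infty\}]$. A sequence $p_n=(x_n,t_n)$ in $\mathbb{H}^2\times\mathbb{R}$ converges to $(x,t)\in\partial_\infty(\mathbb{H}^2\times\mathbb{R})$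 if $x_n\to x$ in $\mathbb{H}^2\cup\partial_\infty\mathbb{H}^2$ (Euclidean convergence in the closed Poincaré disc) and $t_n\to t$ in $[-\infty,+\infty]$. For $A\subset\mathbb{H}^2\times\mathbb{R}$, the asymptotic boundary $\partial_\infty A$ is the set of points of $\partial_\infty(\mathbb{H}^2\times\mathbb{R})$ that are limits of sequences of points of $A$. Its positive/negative horizontal part is $\partial_\infty^{\pm}A=\partial_\infty A\cap(\mathbb{H}^2\times\{\pm\infty\})$. Conventions. A family of curves in $\mathbb{H}^2\times\{\pm\infty\}$ is proper if it is locally finite, i.e. every compact subset of $\mathbb{H}^2\times\{\pm\infty\}$ meets only finitely many curves of the family. That $M\cup\alpha$ is a continuous surface with boundary is meant with respect to the topology of the compactification just described, with $\alpha$ being boundary. *)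

theory Defs
  imports "HOL-Analysis.Analysis"
begin

section \<open>Smooth maps and surfaces with boundary\<close>

text \<open>
  Derivatives are taken within the domain S. The definition is meant for S relatively open in a
  vector space or in a closed half-space; there derivatives within S are unique, and smoothness
  at the points of the bounding hyperplane is smoothness up to the boundary.
\<close>

primrec Ck_on :: "nat \<Rightarrow> 'p::real_normed_vector set \<Rightarrow> ('p \<Rightarrow> 'q::real_normed_vector) \<Rightarrow> bool" where
  "Ck_on 0 S f \<longleftrightarrow> continuous_on S f"
| "Ck_on (Suc k) S f \<longleftrightarrow>
     f differentiable_on S \<and>
     (\<forall>v. Ck_on k S (\<lambda>x. frechet_derivative f (at x within S) v))"

definition smooth_map_on :: "'p::real_normed_vector set \<Rightarrow> ('p \<Rightarrow> 'q::real_normed_vector) \<Rightarrow> bool" where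
  "smooth_map_on S f \<longleftrightarrow> (\<forall>k. Ck_on k S f)"

definition half_plane :: "(real \<times> real) set" where
  "half_plane = {u. snd u \<ge> 0}"

text \<open>A chart is given by its inverse, a local parametrization phi defined on U.\<close>

type_synonym 'a chart = "(real \<times> real) set \<times> (real \<times> real \<Rightarrow> 'a)"

definition surface_chart :: "'a topology \<Rightarrow> 'a chart \<Rightarrow> bool" where
  "surface_chart X = (\<lambda>(U, \<phi>).
     openin (top_of_set half_plane) U \<and>
     openin X (\<phi> ` U) \<and>
     homeomorphic_map (top_of_set U) (subtopology X (\<phi> ` U)) \<phi>)"

definition topological_surface :: "'a topology \<Rightarrow> bool" where
  "topological_surface X \<longleftrightarrow>
     Hausdorff_space X \<and> second_countable X \<and>
     (\<forall>x\<in>topspace X. \<exists>U \<phi>. surface_chart X (U, \<phi>) \<and> x \<in> \<phi> ` U)"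

text \<open>
  By invariance of domain it does not matter whether one chart or every chart around a point sends
  it to the bounding line.
\<close>

definition surface_boundary :: "'a topology \<Rightarrow> 'a set" where
  "surface_boundary X = {\<phi> u |U \<phi> u. surface_chart X (U, \<phi>) \<and> u \<in> U \<and> snd u = 0}"

definition smooth_surface :: "'a topology \<Rightarrow> 'a chart set \<Rightarrow> bool" where
  "smooth_surface X \<A> \<longleftrightarrow>
     topological_surface X \<and>
     (\<forall>c\<in>\<A>. surface_chart X c) \<and>
     topspace X = (\<Union>(U, \<phi>)\<in>\<A>. \<phi> ` U) \<and>
     (\<forall>(U, \<phi>)\<in>\<A>. \<forall>(V, \<psi>)\<in>\<A>.
        smooth_map_on {u\<in>U. \<phi> u \<in> \<psi> ` V} (\<lambda>u. inv_into V \<psi> (\<phi> u)))"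


section \<open>The hyperbolic plane and its product with the real line\<close>

text \<open>
  The hyperbolic plane is the Poincare disc, with metric \<open>4 |dz|^2 / (1 - |z|^2)^2\<close>.
\<close>

definition hyp_plane :: "complex set" where
  "hyp_plane = ball 0 1"

definition hyp_metric :: "complex \<Rightarrow> complex \<Rightarrow> complex \<Rightarrow> real" where
  "hyp_metric z v w = (2 / (1 - (norm z)\<^sup>2))\<^sup>2 * (v \<bullet> w)"

text \<open>
  The Levi-Civita connection of a conformal metric \<open>e^(2 \<psi>) |dz|^2\<close> is
  \<open>D_v w + d\<psi>(v) w + d\<psi>(w) v - (v \<bullet> w) grad \<psi>\<close>;
  here \<open>grad \<psi> = 2 z / (1 - |z|^2)\<close>.
\<close>

definition hyp_christoffel :: "complex \<Rightarrow> complex \<Rightarrow> complex \<Rightarrow> complex" where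
  "hyp_christoffel z v w =
     (2 / (1 - (norm z)\<^sup>2)) *\<^sub>R ((z \<bullet> v) *\<^sub>R w + (z \<bullet> w) *\<^sub>R v - (v \<bullet> w) *\<^sub>R z)"

lemma hyp_christoffel_commute: "hyp_christoffel z v w = hyp_christoffel z w v"
  by (simp add: hyp_christoffel_def inner_commute add.commute)

lemma hyp_christoffel_metric:
  assumes "z \<in> hyp_plane"
  shows "((\<lambda>z. hyp_metric z v w) has_derivative
           (\<lambda>d. hyp_metric z (hyp_christoffel z d v) w + hyp_metric z v (hyp_christoffel z d w))) (at z)"
proof -
  have nz: "1 - z \<bullet> z \<noteq> 0"
  proof -
    have "norm z < 1" using assms by (simp add: hyp_plane_def)
    then have "(norm z)\<^sup>2 < 1" by (simp add: abs_square_less_1)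
    then show ?thesis by (simp add: power2_norm_eq_inner)
  qed
  have "((\<lambda>q. (2 / (1 - q))\<^sup>2) has_real_derivative 8 / (1 - z \<bullet> z) ^ 3) (at (z \<bullet> z))"
    using nz by (auto intro!: derivative_eq_intros simp: divide_simps power2_eq_square power3_eq_cube)
  then have "((\<lambda>z. (2 / (1 - z \<bullet> z))\<^sup>2) has_derivative
      (\<lambda>d. 8 / (1 - z \<bullet> z) ^ 3 * (z \<bullet> d + d \<bullet> z))) (at z)"
    unfolding has_field_derivative_def
    by (rule has_derivative_compose[rotated]) (auto intro!: derivative_eq_intros)
  then have "((\<lambda>z. (2 / (1 - z \<bullet> z))\<^sup>2 * (v \<bullet> w)) has_derivative
      (\<lambda>d. 8 / (1 - z \<bullet> z) ^ 3 * (z \<bullet> d + d \<bullet> z) * (v \<bullet> w))) (at z)"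
    by (rule has_derivative_mult_left)
  moreover have "8 / (1 - z \<bullet> z) ^ 3 * (z \<bullet> d + d \<bullet> z) * (v \<bullet> w) =
      hyp_metric z (hyp_christoffel z d v) w + hyp_metric z v (hyp_christoffel z d w)" for d
  proof -
    define r where "r = 1 - z \<bullet> z"
    have "r \<noteq> 0" using nz by (simp add: r_def)
    then show ?thesis
      unfolding hyp_metric_def hyp_christoffel_def power2_norm_eq_inner r_def[symmetric]
      by (simp add: inner_simps inner_commute power2_eq_square power3_eq_cube divide_simps)
  qed
  ultimately show ?thesis
    by (simp add: hyp_metric_def power2_norm_eq_inner)
qed

definition complete_hyp_geodesic :: "complex set \<Rightarrow> bool" where
  "complete_hyp_geodesic G \<longleftrightarrow>
     (\<exists>c c' :: real \<Rightarrow> complex.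
        G = range c \<and>
        (\<forall>t. c t \<in> hyp_plane \<and>
             hyp_metric (c t) (c' t) (c' t) = 1 \<and>
             (c has_vector_derivative c' t) (at t) \<and>
             (c' has_vector_derivative - hyp_christoffel (c t) (c' t) (c' t)) (at t)))"

definition hyp_product :: "(complex \<times> real) set" where
  "hyp_product = hyp_plane \<times> UNIV"

definition product_metric :: "complex \<times> real \<Rightarrow> complex \<times> real \<Rightarrow> complex \<times> real \<Rightarrow> real" where
  "product_metric p v w = hyp_metric (fst p) (fst v) (fst w) + snd v * snd w"

definition product_christoffel ::
    "complex \<times> real \<Rightarrow> complex \<times> real \<Rightarrow> complex \<times> real \<Rightarrow> complex \<times> real" where
  "product_christoffel p v w = (hyp_christoffel (fst p) (fst v) (fst w), 0)"

definition vertical_field :: "complex \<times> real" where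
  "vertical_field = (0, 1)"


section \<open>Translators\<close>

definition smooth_immersion ::
    "'a topology \<Rightarrow> 'a chart set \<Rightarrow> ('a \<Rightarrow> complex \<times> real) \<Rightarrow> bool" where
  "smooth_immersion X \<A> F \<longleftrightarrow>
     F ` topspace X \<subseteq> hyp_product \<and>
     (\<forall>(U, \<phi>)\<in>\<A>. smooth_map_on U (F \<circ> \<phi>) \<and>
        (\<forall>u\<in>U. inj (frechet_derivative (F \<circ> \<phi>) (at u within U))))"

text \<open>In the next definitions f is a parametrized surface with domain U.\<close>

definition unit_normal ::
    "(real \<times> real) set \<Rightarrow> (real \<times> real \<Rightarrow> complex \<times> real) \<Rightarrow> real \<times> real \<Rightarrow> complex \<times> real \<Rightarrow> bool" where
  "unit_normal U f u N \<longleftrightarrow>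
     product_metric (f u) N N = 1 \<and>
     (\<forall>v. product_metric (f u) N (frechet_derivative f (at u within U) v) = 0)"

definition first_form ::
    "(real \<times> real) set \<Rightarrow> (real \<times> real \<Rightarrow> complex \<times> real) \<Rightarrow> real \<times> real
      \<Rightarrow> real \<times> real \<Rightarrow> real \<times> real \<Rightarrow> real" where
  "first_form U f u v w =
     product_metric (f u) (frechet_derivative f (at u within U) v)
                          (frechet_derivative f (at u within U) w)"

text \<open>The ambient covariant derivative, in the direction v, of the coordinate field \<open>df(w)\<close>.\<close>

definition covariant_hessian ::
    "(real \<times> real) set \<Rightarrow> (real \<times> real \<Rightarrow> complex \<times> real) \<Rightarrow> real \<times> real
      \<Rightarrow> real \<times> real \<Rightarrow> real \<times> real \<Rightarrow> complex \<times> real" where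
  "covariant_hessian U f u v w =
     frechet_derivative (\<lambda>x. frechet_derivative f (at x within U) w) (at u within U) v +
     product_christoffel (f u) (frechet_derivative f (at u within U) v)
                               (frechet_derivative f (at u within U) w)"

definition second_form ::
    "(real \<times> real) set \<Rightarrow> (real \<times> real \<Rightarrow> complex \<times> real) \<Rightarrow> real \<times> real \<Rightarrow> complex \<times> real
      \<Rightarrow> real \<times> real \<Rightarrow> real \<times> real \<Rightarrow> real" where
  "second_form U f u N v w = product_metric (f u) (covariant_hessian U f u v w) N"

text \<open>The trace (not half of it) of the second fundamental form with respect to the first.\<close>

definition mean_curvature ::
    "(real \<times> real) set \<Rightarrow> (real \<times> real \<Rightarrow> complex \<times> real) \<Rightarrow> real \<times> real \<Rightarrow> complex \<times> real \<Rightarrow> real" where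
  "mean_curvature U f u N =
     (let E = first_form U f u (1, 0) (1, 0);
          F = first_form U f u (1, 0) (0, 1);
          G = first_form U f u (0, 1) (0, 1);
          L = second_form U f u N (1, 0) (1, 0);
          M = second_form U f u N (1, 0) (0, 1);
          K = second_form U f u N (0, 1) (0, 1)
      in (G * L - 2 * F * M + E * K) / (E * G - F\<^sup>2))"

text \<open>
  Replacing N by -N changes the sign of both sides of the translator equation, so it is required
  for both unit normals at each point and no orientation is needed.
\<close>

definition translator :: "'a topology \<Rightarrow> 'a chart set \<Rightarrow> ('a \<Rightarrow> complex \<times> real) \<Rightarrow> bool" where
  "translator X \<A> F \<longleftrightarrow>
     smooth_surface X \<A> \<and> smooth_immersion X \<A> F \<and>
     (\<forall>(U, \<phi>)\<in>\<A>. \<forall>u\<in>U. \<forall>N. unit_normal U (F \<circ> \<phi>) u N \<longrightarrow>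
        mean_curvature U (F \<circ> \<phi>) u N = product_metric (F (\<phi> u)) N vertical_field)"

definition properly_immersed :: "'a topology \<Rightarrow> ('a \<Rightarrow> complex \<times> real) \<Rightarrow> bool" where
  "properly_immersed X F \<longleftrightarrow> continuous_map X (top_of_set hyp_product) F \<and>
     proper_map X (top_of_set hyp_product) F"


section \<open>Asymptotic boundary\<close>

text \<open>
  The compactification is the product of the closed unit disc and the extended real line, with the
  product topology of \<^typ>\<open>complex \<times> ereal\<close>.
\<close>

definition to_compactification :: "complex \<times> real \<Rightarrow> complex \<times> ereal" where
  "to_compactification p = (fst p, ereal (snd p))"

definition boundary_at_infinity :: "(complex \<times> ereal) set" where
  "boundary_at_infinity =
     (sphere 0 1 \<times> range ereal) \<union> (hyp_plane \<times> {\<infinity>, -\<infinity>}) \<union> (sphere 0 1 \<times> {\<infinity>, -\<infinity>})"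

definition asymptotic_boundary :: "(complex \<times> real) set \<Rightarrow> (complex \<times> ereal) set" where
  "asymptotic_boundary A =
     {q \<in> boundary_at_infinity.
        \<exists>p :: nat \<Rightarrow> complex \<times> real. range p \<subseteq> A \<and> (\<lambda>n. to_compactification (p n)) \<longlonglongrightarrow> q}"

text \<open>The positive and the negative horizontal part, for s equal to plus and minus infinity.\<close>

definition horizontal_asymptotic_boundary :: "ereal \<Rightarrow> (complex \<times> real) set \<Rightarrow> (complex \<times> ereal) set" where
  "horizontal_asymptotic_boundary s A = asymptotic_boundary A \<inter> (hyp_plane \<times> {s})"

text \<open>
  The image of a continuous immersion (a locally injective continuous map) of an interval; closed
  curves are included as images of periodic immersions of the line.
\<close>

definition immersed_continuous_curve :: "'b::topological_space set \<Rightarrow> bool" where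
  "immersed_continuous_curve S \<longleftrightarrow>
     (\<exists>I (c :: real \<Rightarrow> 'b).
        is_interval I \<and> interior I \<noteq> {} \<and> continuous_on I c \<and>
        (\<forall>t\<in>I. \<exists>e>0. inj_on c (I \<inter> ball t e)) \<and> S = c ` I)"

definition proper_family_of_disjoint_curves :: "ereal \<Rightarrow> (complex \<times> ereal) set set \<Rightarrow> bool" where
  "proper_family_of_disjoint_curves s \<C> \<longleftrightarrow>
     (\<forall>S\<in>\<C>. immersed_continuous_curve S \<and> S \<subseteq> hyp_plane \<times> {s}) \<and>
     disjoint \<C> \<and>
     (\<forall>K. compact K \<and> K \<subseteq> hyp_plane \<times> {s} \<longrightarrow> finite {S\<in>\<C>. S \<inter> K \<noteq> {}})"

text \<open>
  The union of the immersed surface and the curve \<open>\<alpha>\<close> is a continuous surface with boundary, and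
  \<open>\<alpha>\<close> is boundary: Y is a surface consisting of X as an open part (left summands) and a
  connected curve in the boundary of Y (right summands; the reals only supply points), and F
  extends by an immersion c of that curve onto \<open>\<alpha>\<close>. Continuity and properness into the
  compactification say that the topology of Y is the one induced by the compactification; for
  injective F and c, Y is homeomorphic to the subspace that is the union of the image of F and
  \<open>\<alpha>\<close>.
\<close>

definition surface_with_asymptotic_curve ::
    "'a topology \<Rightarrow> ('a \<Rightarrow> complex \<times> real) \<Rightarrow> (complex \<times> ereal) set \<Rightarrow> bool" where
  "surface_with_asymptotic_curve X F \<alpha> \<longleftrightarrow>
     (\<exists>(Y :: ('a + real) topology) (J :: real set) (c :: real \<Rightarrow> complex \<times> ereal).
        topological_surface Y \<and>
        topspace Y = Inl ` topspace X \<union> Inr ` J \<and>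
        continuous_map X Y Inl \<and> open_map X Y Inl \<and>
        Inr ` J \<subseteq> surface_boundary Y \<and> connectedin Y (Inr ` J) \<and>
        c ` J = \<alpha> \<and>
        (\<forall>j\<in>J. \<exists>W. openin Y W \<and> Inr j \<in> W \<and> inj_on c {i\<in>J. Inr i \<in> W}) \<and>
        (let Z = top_of_set (to_compactification ` hyp_product \<union> \<alpha>);
             F' = case_sum (to_compactification \<circ> F) c
         in continuous_map Y Z F' \<and> proper_map Y Z F'))"

end

theory Submission
  imports Defs
begin

text \<open>
  Let \<open>x\<close> and \<open>h\<close> be the projections to the hyperbolic plane and to the real line. For a function
  \<open>\<Phi>\<close> on the ambient space, the translator equation says that
  \<open>\<Delta>\<Phi> + \<langle>\<partial>\<^sub>h, \<nabla>\<Phi>\<rangle>\<close>, computed intrinsically on the surface, is the trace of the ambient Hessian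
  of \<open>\<Phi>\<close> over the tangent plane plus \<open>\<partial>\<^sub>h\<Phi>\<close>. A linear function w of the hyperboloid model has
  hyperbolic Hessian w times the metric, so for small c and \<open>h\<close> close to n the test function
  \<open>w(x) - c (h - n)\<^sup>2\<close> has no local maximum on the surface where w is positive.
  If w were nonpositive at the ends of a small arc of \<open>\<alpha>\<close> but positive somewhere on it, then on a
  half-disc of the surface with boundary over this arc, and with n very far out, such a maximum
  would exist. Hence in the Klein model small arcs lie in the chord between their endpoints. So the
  curve is locally a geodesic, it stays on one geodesic by connectedness, and since it is also
  closed it is the whole geodesic.
\<close>

section \<open>Second derivatives\<close>

text \<open>The bottom edge of the half-disc lies at infinite height, where only continuity is
  known, so a maximum of w alone could sit there and would say nothing. The quadratic penalty forces
  the maximum off that edge. It also rules out the top edge, because n is itself a height of the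
  surface, taken so near the curve that on the top edge the penalty exceeds the bound for w. The
  penalty costs little: it adds -2c times the squared tangential part of the vertical field and
  -2c(h - n), while the hyperbolic metric has trace at least 1 on every tangent plane. So a maximum
  satisfies w <= 2c + 2c|h - n|. With d = |h - n| and c one eighth of the value of w on the arc, the
  size of the maximum means w > 4c + c d^2, and d^2 - 2d + 2 > 0 excludes this at every height. Only
  |h - n| enters, so both ends are covered at once. Linear functions suffice because the sets w <= 0
  include all half-planes bounded by geodesics; in the Klein model these are the affine half-planes,
  and they separate points from chords.\<close>

lemma double_difference_mean_value:
  fixes g :: "real \<Rightarrow> real \<Rightarrow> real"
  assumes "0 < h"
    and gx: "\<And>x y. a \<le> x \<Longrightarrow> x \<le> a + h \<Longrightarrow> b \<le> y \<Longrightarrow> y \<le> b + h \<Longrightarrow>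
      ((\<lambda>x. g x y) has_real_derivative gx x y) (at x)"
    and gxy: "\<And>x y. a \<le> x \<Longrightarrow> x \<le> a + h \<Longrightarrow> b \<le> y \<Longrightarrow> y \<le> b + h \<Longrightarrow>
      ((\<lambda>y. gx x y) has_real_derivative gxy x y) (at y)"
  shows "\<exists>x y. a \<le> x \<and> x \<le> a + h \<and> b \<le> y \<and> y \<le> b + h \<and>
    g (a + h) (b + h) - g (a + h) b - g a (b + h) + g a b = h * h * gxy x y"
proof -
  have "\<exists>x>a. x < a + h \<and>
      (g (a + h) (b + h) - g (a + h) b) - (g a (b + h) - g a b) = (a + h - a) * (gx x (b + h) - gx x b)"
    by (rule MVT2) (use assms in \<open>auto intro!: DERIV_diff\<close>)
  then obtain x where x: "a < x" "x < a + h"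
    and eqx: "g (a + h) (b + h) - g (a + h) b - (g a (b + h) - g a b) = h * (gx x (b + h) - gx x b)"
    by auto
  have "\<exists>y>b. y < b + h \<and> gx x (b + h) - gx x b = (b + h - b) * gxy x y"
    by (rule MVT2) (use assms x in auto)
  then obtain y where y: "b < y" "y < b + h" and "gx x (b + h) - gx x b = h * gxy x y"
    by auto
  with eqx have "g (a + h) (b + h) - g (a + h) b - g a (b + h) + g a b = h * h * gxy x y"
    by (simp add: algebra_simps)
  with x y show ?thesis by (intro exI[of _ x] exI[of _ y]) auto
qed

text \<open>The second difference of \<open>g\<close> over a small square is symmetric in the two
  variables, so it is the area times a value of \<open>g12\<close> and also the area times a value
  of \<open>g21\<close>; continuity compares both values with those at \<open>p\<close>.\<close>

lemma mixed_derivatives_commute: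
  fixes g :: "real \<times> real \<Rightarrow> real"
  assumes "open S" "p \<in> S"
    and g1: "\<And>q. q \<in> S \<Longrightarrow> ((\<lambda>x. g (x, snd q)) has_real_derivative g1 q) (at (fst q))"
    and g2: "\<And>q. q \<in> S \<Longrightarrow> ((\<lambda>y. g (fst q, y)) has_real_derivative g2 q) (at (snd q))"
    and g12: "\<And>q. q \<in> S \<Longrightarrow> ((\<lambda>x. g2 (x, snd q)) has_real_derivative g12 q) (at (fst q))"
    and g21: "\<And>q. q \<in> S \<Longrightarrow> ((\<lambda>y. g1 (fst q, y)) has_real_derivative g21 q) (at (snd q))"
    and cont: "continuous_on S g12" "continuous_on S g21"
  shows "g12 p = g21 p"
proof -
  have "\<bar>g12 p - g21 p\<bar> \<le> e" if "e > 0" for e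
  proof -
    obtain d0 where d0: "d0 > 0" "ball p d0 \<subseteq> S"
      using assms open_contains_ball by metis
    obtain d1 where d1: "d1 > 0" "\<And>q. q \<in> S \<Longrightarrow> dist q p < d1 \<Longrightarrow> dist (g12 q) (g12 p) < e / 2"
      using cont(1) \<open>p \<in> S\<close> \<open>e > 0\<close> unfolding continuous_on_iff by (metis half_gt_zero)
    obtain d2 where d2: "d2 > 0" "\<And>q. q \<in> S \<Longrightarrow> dist q p < d2 \<Longrightarrow> dist (g21 q) (g21 p) < e / 2"
      using cont(2) \<open>p \<in> S\<close> \<open>e > 0\<close> unfolding continuous_on_iff by (metis half_gt_zero)
    \<comment> \<open>Points of the square of side \<open>h\<close> with corner \<open>p\<close> are
      within 2h < 3h of \<open>p\<close>, hence in \<open>S\<close> and within both continuity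
      radii.\<close>
    define h where "h = Min {d0, d1, d2} / 3"
    have h: "h > 0" "3 * h \<le> d0" "3 * h \<le> d1" "3 * h \<le> d2"
      using d0 d1 d2 by (auto simp: h_def min_def)
    obtain a b where p: "p = (a, b)" by fastforce
    have near: "dist (x, y) p < 3 * h"
      if "a \<le> x" "x \<le> a + h" "b \<le> y" "y \<le> b + h" for x y
    proof -
      have "dist (x, y) p \<le> dist x a + dist y b"
        unfolding p dist_Pair_Pair by (rule sqrt_sum_squares_le_sum) auto
      also have "\<dots> < 3 * h" using that h by (auto simp: dist_real_def)
      finally show ?thesis .
    qed
    then have inS: "(x, y) \<in> S" if "a \<le> x" "x \<le> a + h" "b \<le> y" "y \<le> b + h" for x y
      using that d0 h by (smt (verit) dist_commute mem_ball subsetD)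
    have "\<exists>x y. a \<le> x \<and> x \<le> a + h \<and> b \<le> y \<and> y \<le> b + h \<and>
        g (a + h, b + h) - g (a + h, b) - g (a, b + h) + g (a, b) = h * h * g21 (x, y)"
      by (rule double_difference_mean_value[where g = "\<lambda>x y. g (x, y)" and gx = "\<lambda>x y. g1 (x, y)"])
        (use h g1[OF inS] g21[OF inS] in auto)
    then obtain x y where xy: "a \<le> x" "x \<le> a + h" "b \<le> y" "y \<le> b + h"
      "g (a + h, b + h) - g (a + h, b) - g (a, b + h) + g (a, b) = h * h * g21 (x, y)" by blast
    have "\<exists>y x. b \<le> y \<and> y \<le> b + h \<and> a \<le> x \<and> x \<le> a + h \<and>
        g (a + h, b + h) - g (a, b + h) - g (a + h, b) + g (a, b) = h * h * g12 (x, y)"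
      by (rule double_difference_mean_value[where g = "\<lambda>y x. g (x, y)" and gx = "\<lambda>y x. g2 (x, y)"])
        (use h g2[OF inS] g12[OF inS] in auto)
    then obtain x' y' where xy': "a \<le> x'" "x' \<le> a + h" "b \<le> y'" "y' \<le> b + h"
      "g (a + h, b + h) - g (a, b + h) - g (a + h, b) + g (a, b) = h * h * g12 (x', y')" by blast
    have "h * h * g21 (x, y) = h * h * g12 (x', y')" using xy(5) xy'(5) by linarith
    with h have "g21 (x, y) = g12 (x', y')" by auto
    moreover have "dist (g21 (x, y)) (g21 p) < e / 2"
      using d2(2) inS[OF xy(1-4)] near[OF xy(1-4)] h by force
    moreover have "dist (g12 (x', y')) (g12 p) < e / 2"
      using d1(2) inS[OF xy'(1-4)] near[OF xy'(1-4)] h by force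
    ultimately show ?thesis by (auto simp: dist_real_def abs_if split: if_splits)
  qed
  then show ?thesis
    using field_le_epsilon[of "\<bar>g12 p - g21 p\<bar>" 0] by simp
qed

text \<open>If \<open>l\<close> were positive, \<open>g'\<close> would be positive just to the right
  of 0 and \<open>g\<close> would increase there.\<close>

lemma second_derivative_local_max:
  fixes g :: "real \<Rightarrow> real"
  assumes "d > 0"
    and g: "\<And>t. \<bar>t\<bar> < d \<Longrightarrow> (g has_real_derivative g' t) (at t)"
    and g': "(g' has_real_derivative l) (at 0)"
    and max: "\<And>t. \<bar>t\<bar> < d \<Longrightarrow> g t \<le> g 0"
  shows "g' 0 = 0" "l \<le> 0"
proof -
  show g0: "g' 0 = 0"
    by (rule DERIV_local_max[of g _ 0 d]) (use g[of 0] max \<open>d > 0\<close> in auto)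
  show "l \<le> 0"
  proof (rule ccontr)
    assume "\<not> l \<le> 0"
    then obtain e where e: "e > 0" "\<And>h. h > 0 \<Longrightarrow> h < e \<Longrightarrow> g' 0 < g' (0 + h)"
      using DERIV_pos_inc_right[OF g'] by auto
    define s where "s = min e d / 2"
    have s: "0 < s" "s < e" "s < d" using \<open>e > 0\<close> \<open>d > 0\<close> by (auto simp: s_def)
    have "\<exists>z>0. z < s \<and> g s - g 0 = (s - 0) * g' z"
      by (rule MVT2) (use s g in auto)
    then obtain z where "0 < z" "z < s" "g s - g 0 = s * g' z" by auto
    moreover have "g' z > 0" using e(2)[of z] g0 \<open>0 < z\<close> \<open>z < s\<close> s by auto
    ultimately have "g s > g 0" using mult_pos_pos[of s "g' z"] s by linarith
    then show False using max[of s] s by auto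
  qed
qed

section \<open>Hyperboloid coordinates\<close>

text \<open>
  In the hyperboloid model these are the restrictions of the linear functions
  \<open>A * X0 + B1 * X1 + B2 * X2\<close>; their hyperbolic Hessian is the function times the metric.
\<close>

definition hyp_linear :: "real \<Rightarrow> complex \<Rightarrow> complex \<Rightarrow> real" where
  "hyp_linear A B z = (A * (1 + z \<bullet> z) + 2 * (B \<bullet> z)) / (1 - z \<bullet> z)"

definition hyp_linear_deriv :: "real \<Rightarrow> complex \<Rightarrow> complex \<Rightarrow> complex \<Rightarrow> real" where
  "hyp_linear_deriv A B z x =
     2 * (B \<bullet> x) / (1 - z \<bullet> z) + 4 * (A + B \<bullet> z) * (z \<bullet> x) / (1 - z \<bullet> z)\<^sup>2"

definition hyp_linear_deriv2 :: "real \<Rightarrow> complex \<Rightarrow> complex \<Rightarrow> complex \<Rightarrow> complex \<Rightarrow> real" where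
  "hyp_linear_deriv2 A B z x y =
     4 * ((B \<bullet> x) * (z \<bullet> y) + (B \<bullet> y) * (z \<bullet> x) + (A + B \<bullet> z) * (x \<bullet> y)) / (1 - z \<bullet> z)\<^sup>2 +
     16 * (A + B \<bullet> z) * (z \<bullet> x) * (z \<bullet> y) / (1 - z \<bullet> z) ^ 3"

lemma hyp_plane_inner: "z \<in> hyp_plane \<Longrightarrow> z \<bullet> z < 1"
  by (simp add: hyp_plane_def abs_square_less_1 flip: power2_norm_eq_inner)

text \<open>Along a unit speed geodesic the position vector on the hyperboloid satisfies X'' = X,
  and so does every linear function of it. Here the identity is checked in disc coordinates, with
  \<open>r\<close> as the only denominator.\<close>

lemma hyp_linear_hessian:
  assumes "z \<in> hyp_plane"
  shows "hyp_linear_deriv2 A B z x y - hyp_linear_deriv A B z (hyp_christoffel z x y) =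
    hyp_linear A B z * hyp_metric z x y"
proof -
  define r where "r = 1 - z \<bullet> z"
  have "r \<noteq> 0" using hyp_plane_inner[OF assms] by (simp add: r_def)
  have zz: "z \<bullet> z = 1 - r" by (simp add: r_def)
  show ?thesis
    unfolding hyp_linear_deriv2_def hyp_linear_deriv_def hyp_linear_def hyp_metric_def
      hyp_christoffel_def power2_norm_eq_inner
    using \<open>r \<noteq> 0\<close>
    by (simp add: inner_simps zz inner_commute[of x y] divide_simps) (simp add: algebra_simps eval_nat_numeral)
qed

lemma has_real_derivative_inner:
  assumes "(p has_vector_derivative p') (at t)" "(q has_vector_derivative q') (at t)"
  shows "((\<lambda>s. p s \<bullet> q s) has_real_derivative p t \<bullet> q' + p' \<bullet> q t) (at t)"
  unfolding has_field_derivative_def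
  by (rule has_derivative_eq_rhs[OF has_derivative_inner[OF assms[unfolded has_vector_derivative_def]]])
    (auto simp: algebra_simps)

lemma hyp_linear_has_derivative_curve:
  assumes p: "(p has_vector_derivative p') (at t)" and "p t \<in> hyp_plane"
  shows "((\<lambda>s. hyp_linear A B (p s)) has_real_derivative hyp_linear_deriv A B (p t) p') (at t)"
proof -
  define r where "r = 1 - p t \<bullet> p t"
  have r: "r \<noteq> 0" "p t \<bullet> p t = 1 - r" using hyp_plane_inner[OF assms(2)] by (auto simp: r_def)
  have b: "((\<lambda>s. B \<bullet> p s) has_real_derivative B \<bullet> p') (at t)"
    using has_real_derivative_inner[OF has_vector_derivative_const p, of B] by simp
  have m: "((\<lambda>s. p s \<bullet> p s) has_real_derivative 2 * (p t \<bullet> p')) (at t)"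
    using has_real_derivative_inner[OF p p] by (simp add: inner_commute)
  show ?thesis
    unfolding hyp_linear_def hyp_linear_deriv_def using r
    by (auto intro!: derivative_eq_intros b m simp: divide_simps)
      (simp add: algebra_simps power2_eq_square)
qed

text \<open>With \<open>q\<close> the velocity of \<open>p\<close> this is the second derivative
  along a curve that need not be a geodesic; the term with \<open>q'\<close> comes from its
  acceleration.\<close>

lemma hyp_linear_deriv_has_derivative_curve:
  assumes p: "(p has_vector_derivative p') (at t)" and q: "(q has_vector_derivative q') (at t)"
    and "p t \<in> hyp_plane"
  shows "((\<lambda>s. hyp_linear_deriv A B (p s) (q s)) has_real_derivative
    hyp_linear_deriv2 A B (p t) p' (q t) + hyp_linear_deriv A B (p t) q') (at t)"
proof -
  define r where "r = 1 - p t \<bullet> p t"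
  have r: "r \<noteq> 0" "p t \<bullet> p t = 1 - r" using hyp_plane_inner[OF assms(3)] by (auto simp: r_def)
  have b: "((\<lambda>s. B \<bullet> p s) has_real_derivative B \<bullet> p') (at t)"
    using has_real_derivative_inner[OF has_vector_derivative_const p, of B] by simp
  have e: "((\<lambda>s. B \<bullet> q s) has_real_derivative B \<bullet> q') (at t)"
    using has_real_derivative_inner[OF has_vector_derivative_const q, of B] by simp
  have k: "((\<lambda>s. p s \<bullet> q s) has_real_derivative (p t \<bullet> q' + p' \<bullet> q t)) (at t)"
    using has_real_derivative_inner[OF p q] by simp
  have m: "((\<lambda>s. p s \<bullet> p s) has_real_derivative 2 * (p t \<bullet> p')) (at t)"
    using has_real_derivative_inner[OF p p] by (simp add: inner_commute)
  show ?thesis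
    unfolding hyp_linear_deriv2_def hyp_linear_deriv_def using r
    by (auto intro!: derivative_eq_intros b e k m)
      (simp add: divide_simps inner_commute; simp add: algebra_simps eval_nat_numeral inner_commute)
qed

section \<open>The maximum principle\<close>

text \<open>At a maximum the trace of the Hessian is nonpositive. Here \<open>m11\<close>,
  \<open>m12\<close>, \<open>m22\<close> are the hyperbolic part of the first form,
  \<open>y1\<close>, \<open>y2\<close> the vertical components of the coordinate vectors, and
  \<open>l11\<close>, \<open>l12\<close>, \<open>l22\<close> come from the covariant second
  derivatives. The hyperbolic metric contributes \<open>w\<close> times 2 minus the squared length
  of the projected vertical field, hence at least \<open>w\<close> when \<open>w\<close> is
  positive.\<close>

lemma trace_negative_semidefinite:
  fixes w c k m11 m12 m22 y1 y2 l11 l12 l22 :: real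
  defines "Q11 \<equiv> w * m11 - 2 * c * (y1 * y1) + l11"
    and "Q12 \<equiv> w * m12 - 2 * c * (y1 * y2) + l12"
    and "Q22 \<equiv> w * m22 - 2 * c * (y2 * y2) + l22"
    and "E \<equiv> m11 + y1 * y1" and "F \<equiv> m12 + y1 * y2" and "G \<equiv> m22 + y2 * y2"
  assumes "c \<ge> 0" "E > 0" "E * G - F\<^sup>2 > 0" "m12\<^sup>2 \<le> m11 * m22"
    and neg: "\<And>a b. a\<^sup>2 * Q11 + 2 * a * b * Q12 + b\<^sup>2 * Q22 \<le> 0"
    and trace: "G * l11 - 2 * F * l12 + E * l22 = (E * G - F\<^sup>2) * (- 2 * c * k)"
  shows "w \<le> 2 * c + 2 * c * \<bar>k\<bar>"
proof (rule ccontr)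
  assume big: "\<not> ?thesis"
  define D where "D = E * G - F\<^sup>2"
  define T where "T = G * y1\<^sup>2 - 2 * F * y1 * y2 + E * y2\<^sup>2"
  \<comment> \<open>The vector (-F, E) is orthogonal to the first coordinate vector, so up to
    positive factors the trace is the sum of the form on these two directions.\<close>
  have "E * (G * Q11 - 2 * F * Q12 + E * Q22) = D * Q11 + ((- F)\<^sup>2 * Q11 + 2 * (- F) * E * Q12 + E\<^sup>2 * Q22)"
    by (simp add: D_def algebra_simps power2_eq_square)
  also have "\<dots> \<le> 0"
    using neg[of 1 0] neg[of "- F" E] assms(9) by (simp add: D_def add_nonpos_nonpos mult_nonneg_nonpos)
  finally have "G * Q11 - 2 * F * Q12 + E * Q22 \<le> 0"
    using \<open>E > 0\<close> by (simp add: mult_le_0_iff)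
  moreover have "G * Q11 - 2 * F * Q12 + E * Q22 =
      w * (2 * D - T) - 2 * c * T + (G * l11 - 2 * F * l12 + E * l22)"
    by (simp add: D_def T_def Q11_def Q12_def Q22_def E_def F_def G_def algebra_simps power2_eq_square)
  ultimately have le: "w * (2 * D - T) - 2 * c * T - 2 * c * k * D \<le> 0"
    using trace by (simp add: D_def algebra_simps)
  \<comment> \<open>\<open>T / D\<close> is the squared length of the tangential part of the
    vertical field; the difference is the Gram determinant of the hyperbolic parts.\<close>
  have "D - T = m11 * m22 - m12\<^sup>2"
    by (simp add: D_def T_def E_def F_def G_def algebra_simps power2_eq_square)
  with assms(10) have "T \<le> D" by simp
  have "D > 0" using assms(9) by (simp add: D_def)
  have "c * k \<le> c * \<bar>k\<bar>" using \<open>c \<ge> 0\<close> by (simp add: mult_left_mono)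
  moreover have "0 \<le> 2 * c + 2 * c * \<bar>k\<bar>" using \<open>c \<ge> 0\<close> by simp
  ultimately have w: "w > 0" "w - 2 * c - 2 * c * k > 0" using big by linarith+
  have "w * (2 * D - T) \<ge> w * D" using w \<open>T \<le> D\<close> by (intro mult_left_mono) auto
  moreover have "2 * c * T \<le> 2 * c * D" using \<open>c \<ge> 0\<close> \<open>T \<le> D\<close> by (intro mult_left_mono) auto
  ultimately have "(w - 2 * c - 2 * c * k) * D \<le> 0" using le by (simp add: algebra_simps)
  with w \<open>D > 0\<close> show False by (simp add: mult_le_0_iff)
qed

section \<open>The product metric and the gradient of the test function\<close>

lemma product_metric_commute: "product_metric p v w = product_metric p w v"
  by (simp add: product_metric_def hyp_metric_def inner_commute mult.commute)

lemma product_metric_pos: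
  assumes "p \<in> hyp_product" "v \<noteq> 0"
  shows "product_metric p v v > 0"
proof -
  have "1 - (norm (fst p))\<^sup>2 \<noteq> 0"
    using assms hyp_plane_inner[of "fst p"] by (auto simp: hyp_product_def power2_norm_eq_inner)
  then have "(2 / (1 - (norm (fst p))\<^sup>2))\<^sup>2 > 0" by simp
  moreover have "fst v \<noteq> 0 \<or> snd v \<noteq> 0" using assms(2) by (auto simp: prod_eq_iff)
  ultimately show ?thesis
    unfolding product_metric_def hyp_metric_def
    by (metis add_nonneg_pos add_pos_nonneg inner_ge_zero inner_gt_zero_iff less_le mult_pos_pos
        not_real_square_gt_zero zero_le_mult_iff zero_le_square)
qed

lemma product_metric_linear:
  "product_metric p (v + v') w = product_metric p v w + product_metric p v' w"
  "product_metric p (a *\<^sub>R v) w = a * product_metric p v w"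
  "product_metric p w (v + v') = product_metric p w v + product_metric p w v'"
  "product_metric p w (a *\<^sub>R v) = a * product_metric p w v"
  by (simp_all add: product_metric_def hyp_metric_def inner_simps algebra_simps)

text \<open>The differential of the test function \<open>\<lambda>(x, h). hyp_linear A B x - c * (h - n)\<^sup>2\<close>.\<close>

definition test_deriv :: "real \<Rightarrow> complex \<Rightarrow> real \<Rightarrow> real \<Rightarrow> complex \<times> real \<Rightarrow> complex \<times> real \<Rightarrow> real" where
  "test_deriv A B c n p v = hyp_linear_deriv A B (fst p) (fst v) - 2 * c * (snd p - n) * snd v"

lemma test_deriv_linear:
  "test_deriv A B c n p (v + w) = test_deriv A B c n p v + test_deriv A B c n p w"
  "test_deriv A B c n p (a *\<^sub>R v) = a * test_deriv A B c n p v"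
  by (simp_all add: test_deriv_def hyp_linear_deriv_def inner_simps add_divide_distrib algebra_simps)

lemma test_deriv_gradient:
  assumes "p \<in> hyp_product"
  shows "\<exists>grad. \<forall>v. test_deriv A B c n p v = product_metric p grad v"
proof -
  let ?z = "fst p"
  define r where "r = 1 - ?z \<bullet> ?z"
  have "r \<noteq> 0" using assms hyp_plane_inner[of ?z] by (auto simp: r_def hyp_product_def)
  \<comment> \<open>The horizontal part is the Euclidean gradient divided by the conformal factor 4
    / r^2.\<close>
  define grad where
    "grad = ((r\<^sup>2 / 4) *\<^sub>R ((2 / r) *\<^sub>R B + (4 * (A + B \<bullet> ?z) / r\<^sup>2) *\<^sub>R ?z), - 2 * c * (snd p - n))"
  have "test_deriv A B c n p v = product_metric p grad v" for v
    unfolding test_deriv_def hyp_linear_deriv_def product_metric_def hyp_metric_def grad_def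
      power2_norm_eq_inner r_def[symmetric]
    using \<open>r \<noteq> 0\<close> by (simp add: inner_simps divide_simps power2_eq_square)
  then show ?thesis by blast
qed

text \<open>
  At a critical point of the test function on the surface its ambient gradient is a multiple of the
  normal, so the translator equation determines the second fundamental form term of its Laplacian.
\<close>

lemma translator_critical_point:
  assumes "f u \<in> hyp_product"
    and lin: "linear (frechet_derivative f (at u within U))"
    and tr: "\<And>N. unit_normal U f u N \<Longrightarrow> mean_curvature U f u N = product_metric (f u) N vertical_field"
    and nondeg: "first_form U f u (1, 0) (1, 0) * first_form U f u (0, 1) (0, 1) - (first_form U f u (1, 0) (0, 1))\<^sup>2 \<noteq> 0"
    and crit: "\<And>v. test_deriv A B c n (f u) (frechet_derivative f (at u within U) v) = 0"
  shows "first_form U f u (0, 1) (0, 1) * test_deriv A B c n (f u) (covariant_hessian U f u (1, 0) (1, 0))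
    - 2 * first_form U f u (1, 0) (0, 1) * test_deriv A B c n (f u) (covariant_hessian U f u (1, 0) (0, 1))
    + first_form U f u (1, 0) (1, 0) * test_deriv A B c n (f u) (covariant_hessian U f u (0, 1) (0, 1))
    = (first_form U f u (1, 0) (1, 0) * first_form U f u (0, 1) (0, 1) - (first_form U f u (1, 0) (0, 1))\<^sup>2)
      * (- 2 * c * (snd (f u) - n))"
proof -
  let ?g = "product_metric (f u)"
  obtain grad where grad: "\<And>v. test_deriv A B c n (f u) v = ?g grad v"
    using test_deriv_gradient[OF assms(1)] by blast
  have vert: "?g grad vertical_field = - 2 * c * (snd (f u) - n)"
    by (simp flip: grad) (simp add: test_deriv_def vertical_field_def hyp_linear_deriv_def)
  show ?thesis
  proof (cases "grad = 0")
    \<comment> \<open>A vanishing gradient yields no normal, but then both sides are 0: the factor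
      -2c(h - n) is the vertical component of \<open>grad\<close>.\<close>
    case True
    then have "?g grad v = 0" for v using product_metric_linear(2)[of "f u" 0 0 v] by simp
    then show ?thesis using vert by (simp add: grad)
  next
    case False
    define l where "l = sqrt (?g grad grad)"
    have l: "l > 0" "l * l = ?g grad grad"
      using product_metric_pos[OF assms(1) False] by (auto simp: l_def)
    define N where "N = (1 / l) *\<^sub>R grad"
    have N: "?g N v = ?g grad v / l" for v by (simp add: N_def product_metric_linear)
    have "?g N N = 1" using l(1) by (simp add: N_def product_metric_linear flip: l(2))
    then have "unit_normal U f u N"
      using crit by (auto simp: unit_normal_def N grad)
    from tr[OF this] have H: "mean_curvature U f u N * l = ?g grad vertical_field"
      using l by (simp add: N)
    have second: "test_deriv A B c n (f u) (covariant_hessian U f u v w) = second_form U f u N v w * l" for v w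
      using l(1) by (simp add: second_form_def product_metric_commute[of _ _ N] N grad)
    let ?E = "first_form U f u (1, 0) (1, 0)" and ?F = "first_form U f u (1, 0) (0, 1)"
      and ?G = "first_form U f u (0, 1) (0, 1)"
    have "?G * second_form U f u N (1, 0) (1, 0) - 2 * ?F * second_form U f u N (1, 0) (0, 1)
        + ?E * second_form U f u N (0, 1) (0, 1) = (?E * ?G - ?F\<^sup>2) * mean_curvature U f u N"
      using nondeg by (simp add: mean_curvature_def Let_def)
    then have "(?G * second_form U f u N (1, 0) (1, 0) - 2 * ?F * second_form U f u N (1, 0) (0, 1)
        + ?E * second_form U f u N (0, 1) (0, 1)) * l = (?E * ?G - ?F\<^sup>2) * (mean_curvature U f u N * l)"
      by simp
    then show ?thesis
      unfolding vert[symmetric] H[symmetric] second by (simp add: algebra_simps)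
  qed
qed

text \<open>Above the bounding line a chart domain is open in the plane, so derivatives within it
  are ordinary derivatives there.\<close>

lemma open_Int_upper:
  assumes "openin (top_of_set half_plane) S"
  shows "open (S \<inter> {u. snd u > 0})"
proof -
  obtain T where T: "open T" "S = half_plane \<inter> T" using assms by (auto simp: openin_open)
  then have "S \<inter> {u. snd u > 0} = T \<inter> {u. snd u > 0}" by (auto simp: half_plane_def)
  then show ?thesis using T(1) by (auto intro!: open_Int open_Collect_less continuous_intros)
qed

lemma has_vector_derivative_line:
  assumes "(f has_derivative D) (at (p + s *\<^sub>R v))"
  shows "((\<lambda>t. f (p + t *\<^sub>R v)) has_vector_derivative D v) (at s)"
proof -
  have "((\<lambda>t. p + t *\<^sub>R v) has_derivative (\<lambda>t. t *\<^sub>R v)) (at s)"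
    by (auto intro!: derivative_eq_intros)
  from has_derivative_compose[OF this assms]
  have "((\<lambda>t. f (p + t *\<^sub>R v)) has_derivative (\<lambda>t. D (t *\<^sub>R v))) (at s)" .
  moreover have "linear D" using assms has_derivative_linear by blast
  ultimately show ?thesis by (simp add: has_vector_derivative_def linear_scale)
qed

text \<open>The mixed term of \<open>covariant_hessian\<close> fixes one order of differentiation,
  whereas the second derivative along a line produces both.\<close>

lemma second_partials_commute:
  fixes f :: "real \<times> real \<Rightarrow> complex \<times> real"
  assumes U: "openin (top_of_set half_plane) U" and sm: "smooth_map_on U f" and u: "u \<in> U" "snd u > 0"
  shows "frechet_derivative (\<lambda>x. frechet_derivative f (at x within U) (1, 0)) (at u within U) (0, 1) =
    frechet_derivative (\<lambda>x. frechet_derivative f (at x within U) (0, 1)) (at u within U) (1, 0)"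
proof -
  let ?d = "\<lambda>v x. frechet_derivative f (at x within U) v"
  let ?dd = "\<lambda>v w x. frechet_derivative (?d v) (at x within U) w"
  have Ck: "Ck_on (Suc (Suc 0)) U f" using sm by (simp add: smooth_map_on_def del: Ck_on.simps)
  define S where "S = interior U"
  have S: "open S" "u \<in> S" using u by (auto simp: S_def intro!: interiorI[OF open_Int_upper[OF U]])
  have atS: "at x within U = at x" "x \<in> U" if "x \<in> S" for x
    using that at_within_interior interior_subset by (auto simp: S_def)
  have d: "(f has_derivative (\<lambda>v. ?d v x)) (at x)" if "x \<in> S" for x
  proof -
    have "f differentiable (at x within U)" using Ck atS[OF that] by (auto simp: differentiable_on_def)
    then show ?thesis unfolding frechet_derivative_works using atS[OF that] by simp
  qed
  have dd: "(?d v has_derivative (\<lambda>w. ?dd v w x)) (at x)" if "x \<in> S" for x v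
  proof -
    have "Ck_on (Suc 0) U (?d v)" using Ck unfolding Ck_on.simps(2)[of "Suc 0"] by blast
    then have "?d v differentiable (at x within U)" using atS(2)[OF that] by (auto simp: differentiable_on_def)
    then show ?thesis unfolding frechet_derivative_works using atS[OF that] by simp
  qed
  have cont: "continuous_on S (?dd v w)" for v w
  proof -
    have "Ck_on 0 U (?dd v w)" using Ck unfolding Ck_on.simps(2) by blast
    then show ?thesis using continuous_on_subset interior_subset unfolding Ck_on.simps S_def by blast
  qed
  have fst_line: "((\<lambda>t. h (t, snd q) \<bullet> e) has_real_derivative D (1, 0) \<bullet> e) (at (fst q))"
    if "(h has_derivative D) (at q)" for h D q and e :: "complex \<times> real"
  proof -
    have "((\<lambda>t. h ((0, snd q) + t *\<^sub>R (1, 0))) has_vector_derivative D (1, 0)) (at (fst q))"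
      by (rule has_vector_derivative_line) (use that in simp)
    from has_real_derivative_inner[OF this has_vector_derivative_const[of e]] show ?thesis by simp
  qed
  have snd_line: "((\<lambda>t. h (fst q, t) \<bullet> e) has_real_derivative D (0, 1) \<bullet> e) (at (snd q))"
    if "(h has_derivative D) (at q)" for h D q and e :: "complex \<times> real"
  proof -
    have "((\<lambda>t. h ((fst q, 0) + t *\<^sub>R (0, 1))) has_vector_derivative D (0, 1)) (at (snd q))"
      by (rule has_vector_derivative_line) (use that in simp)
    from has_real_derivative_inner[OF this has_vector_derivative_const[of e]] show ?thesis by simp
  qed
  show ?thesis
  \<comment> \<open>The scalar statement is applied to the component of \<open>f\<close> along every
    vector \<open>e\<close>.\<close>
  proof (rule vector_eq_rdot[THEN iffD1], rule allI)
    fix e :: "complex \<times> real"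
    show "?dd (1, 0) (0, 1) u \<bullet> e = ?dd (0, 1) (1, 0) u \<bullet> e"
      by (rule sym, rule mixed_derivatives_commute[OF S, where g = "\<lambda>x. f x \<bullet> e"])
        (auto intro!: continuous_intros cont fst_line snd_line d dd)
  qed
qed

text \<open>Restricting the test function to all parameter lines through \<open>u\<close> shows that
  \<open>u\<close> is critical and that the second derivatives form a negative semidefinite matrix.
  At a critical point this matrix is the intrinsic Hessian, so the trace estimate applies, and the
  translator equation evaluates the part of the trace that involves the curvature of the
  surface.\<close>

lemma test_function_max:
  fixes f :: "real \<times> real \<Rightarrow> complex \<times> real"
  assumes U: "openin (top_of_set half_plane) U" and sm: "smooth_map_on U f" and u: "u \<in> U" "snd u > 0"
    and fH: "f ` U \<subseteq> hyp_product"
    and inj: "inj (frechet_derivative f (at u within U))"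
    and tr: "\<And>N. unit_normal U f u N \<Longrightarrow> mean_curvature U f u N = product_metric (f u) N vertical_field"
    and "c \<ge> 0"
    and V: "open V" "u \<in> V" "V \<subseteq> U"
    and max: "\<And>v. v \<in> V \<Longrightarrow> hyp_linear A B (fst (f v)) - c * (snd (f v) - n)\<^sup>2
      \<le> hyp_linear A B (fst (f u)) - c * (snd (f u) - n)\<^sup>2"
  shows "hyp_linear A B (fst (f u)) \<le> 2 * c + 2 * c * \<bar>snd (f u) - n\<bar>"
proof -
  let ?d = "\<lambda>v x. frechet_derivative f (at x within U) v"
  let ?dd = "\<lambda>v w. frechet_derivative (?d v) (at u within U) w"
  let ?L = "test_deriv A B c n (f u)"
  have Ck: "Ck_on (Suc (Suc 0)) U f" using sm by (simp add: smooth_map_on_def del: Ck_on.simps)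
  have atU: "at x within U = at x" "x \<in> U" if "x \<in> V" for x
    using that V interior_maximal[of V U] at_within_interior[of x U] by blast+
  have d: "(f has_derivative (\<lambda>v. ?d v x)) (at x)" if "x \<in> V" for x
  proof -
    have "f differentiable (at x within U)" using Ck atU[OF that] by (auto simp: differentiable_on_def)
    then show ?thesis unfolding frechet_derivative_works using atU[OF that] by simp
  qed
  have dd: "(?d v has_derivative (\<lambda>w. ?dd v w)) (at u)" for v
  proof -
    have "Ck_on (Suc 0) U (?d v)" using Ck unfolding Ck_on.simps(2)[of "Suc 0"] by blast
    then have "?d v differentiable (at u within U)" using u by (auto simp: differentiable_on_def)
    then show ?thesis unfolding frechet_derivative_works using atU[OF V(2)] by simp
  qed
  have lin: "linear (\<lambda>v. ?d v x)" if "x \<in> V" for x using d[OF that] has_derivative_linear by blast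
  have lin2: "linear (?dd v)" for v using dd has_derivative_linear by blast
  have expand: "g (a, b) = a *\<^sub>R g (1, 0) + b *\<^sub>R g (0, 1)" if "linear g" for g :: "real \<times> real \<Rightarrow> complex \<times> real" and a b
  proof -
    have "g (a, b) = g (a *\<^sub>R (1, 0) + b *\<^sub>R (0, 1))" by simp
    also have "\<dots> = a *\<^sub>R g (1, 0) + b *\<^sub>R g (0, 1)"
      unfolding linear_add[OF that] linear_scale[OF that] ..
    finally show ?thesis .
  qed
  let ?z = "fst (f u)"
  have z: "?z \<in> hyp_plane" using fH u by (auto simp: hyp_product_def)
  have line: "?L (?d (a, b) u) = 0 \<and>
      hyp_linear_deriv2 A B ?z (fst (?d (a, b) u)) (fst (?d (a, b) u)) - 2 * c * (snd (?d (a, b) u))\<^sup>2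
        + ?L (a\<^sup>2 *\<^sub>R ?dd (1, 0) (1, 0) + (2 * a * b) *\<^sub>R ?dd (0, 1) (1, 0) + b\<^sup>2 *\<^sub>R ?dd (0, 1) (0, 1)) \<le> 0"
    (is "_ \<and> ?Q \<le> 0") for a b
  proof -
    let ?v = "(a, b)"
    \<comment> \<open>One-variable calculus on the line in direction \<open>(a, b)\<close>:
      \<open>q\<close> is the velocity of the image curve \<open>p\<close>, and \<open>q'\<close>
      below is its acceleration at 0.\<close>
    define p where "p = (\<lambda>t. f (u + t *\<^sub>R ?v))"
    define q where "q = (\<lambda>t. a *\<^sub>R ?d (1, 0) (u + t *\<^sub>R ?v) + b *\<^sub>R ?d (0, 1) (u + t *\<^sub>R ?v))"
    have "open ((\<lambda>t. u + t *\<^sub>R ?v) -` V)"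
      by (rule open_vimage[OF V(1)]) (intro continuous_intros)
    moreover have "0 \<in> (\<lambda>t. u + t *\<^sub>R ?v) -` V" using V(2) by (simp flip: zero_prod_def)
    ultimately obtain \<delta> where \<delta>: "\<delta> > 0" "ball 0 \<delta> \<subseteq> (\<lambda>t. u + t *\<^sub>R ?v) -` V"
      using open_contains_ball by blast
    then have inV: "u + t *\<^sub>R ?v \<in> V" if "\<bar>t\<bar> < \<delta>" for t using that by (auto simp: subset_eq)
    have p: "(p has_vector_derivative q t) (at t)" if "\<bar>t\<bar> < \<delta>" for t
      unfolding p_def q_def using has_vector_derivative_line[OF d[OF inV[OF that]]] expand[OF lin[OF inV[OF that]], of a b]
      by simp
    have p0: "p 0 = f u" by (simp add: p_def flip: zero_prod_def)
    define q' where "q' = a *\<^sub>R ?dd (1, 0) ?v + b *\<^sub>R ?dd (0, 1) ?v"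
    have q: "(q has_vector_derivative q') (at 0)"
      unfolding q_def q'_def
      by (intro has_vector_derivative_add bounded_linear.has_vector_derivative[OF bounded_linear_scaleR_right]
          has_vector_derivative_line[where p = u and s = 0]) (use dd in \<open>simp_all flip: zero_prod_def\<close>)
    have pH: "fst (p t) \<in> hyp_plane" if "\<bar>t\<bar> < \<delta>" for t
      using atU(2)[OF inV[OF that]] fH by (auto simp: p_def hyp_product_def)
    have fstd: "((\<lambda>t. fst (h t)) has_vector_derivative fst h') (at t)"
      if "(h has_vector_derivative h') (at t)" for h :: "real \<Rightarrow> complex \<times> real" and h' t
      using bounded_linear.has_vector_derivative[OF bounded_linear_fst that] .
    have sndd: "((\<lambda>t. snd (h t)) has_real_derivative snd h') (at t)"
      if "(h has_vector_derivative h') (at t)" for h :: "real \<Rightarrow> complex \<times> real" and h' t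
      using bounded_linear.has_vector_derivative[OF bounded_linear_snd that]
      by (simp add: has_real_derivative_iff_has_vector_derivative)
    define g where "g = (\<lambda>t. hyp_linear A B (fst (p t)) - c * (snd (p t) - n)\<^sup>2)"
    define g' where "g' = (\<lambda>t. hyp_linear_deriv A B (fst (p t)) (fst (q t)) - 2 * c * (snd (p t) - n) * snd (q t))"
    have g: "(g has_real_derivative g' t) (at t)" if "\<bar>t\<bar> < \<delta>" for t
      unfolding g_def g'_def
      by (auto intro!: derivative_eq_intros hyp_linear_has_derivative_curve fstd sndd p[OF that] pH[OF that])
    have g': "(g' has_real_derivative
        (hyp_linear_deriv2 A B ?z (fst (q 0)) (fst (q 0)) + hyp_linear_deriv A B ?z (fst q')) -
        (2 * c * snd (q 0) * snd (q 0) + 2 * c * (snd (f u) - n) * snd q')) (at 0)"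
      unfolding g'_def
      using hyp_linear_deriv_has_derivative_curve[OF fstd[OF p[of 0]] fstd[OF q] pH[of 0], of A B]
        sndd[OF p[of 0]] sndd[OF q] \<delta>(1)
      by (auto intro!: derivative_eq_intros simp: p0)
    have mx: "g t \<le> g 0" if "\<bar>t\<bar> < \<delta>" for t
      using max[OF inV[OF that]] unfolding g_def p0 by (simp add: p_def)
    have q0: "q 0 = ?d ?v u" using expand[OF lin[OF V(2)], of a b] by (simp add: q_def flip: zero_prod_def)
    have q'e: "q' = a\<^sup>2 *\<^sub>R ?dd (1, 0) (1, 0) + (2 * a * b) *\<^sub>R ?dd (0, 1) (1, 0) + b\<^sup>2 *\<^sub>R ?dd (0, 1) (0, 1)"
      unfolding q'_def expand[OF lin2, of _ a b] second_partials_commute[OF U sm u]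
      by (simp add: algebra_simps power2_eq_square scaleR_2 flip: scaleR_add_left)
    have "g' 0 = 0" using second_derivative_local_max[OF \<delta>(1) g g' mx] by blast
    then have "?L (?d ?v u) = 0" by (simp add: g'_def q0 test_deriv_def p0)
    moreover have "hyp_linear_deriv2 A B ?z (fst (q 0)) (fst (q 0)) - 2 * c * (snd (q 0))\<^sup>2 + ?L q' \<le> 0"
      using second_derivative_local_max(2)[OF \<delta>(1) g g' mx]
      by (simp add: test_deriv_def power2_eq_square)
    then have "?Q \<le> 0" unfolding q0 q'e .
    ultimately show ?thesis by blast
  qed
  define x1 y1 x2 y2 where "x1 = fst (?d (1, 0) u)" and "y1 = snd (?d (1, 0) u)"
    and "x2 = fst (?d (0, 1) u)" and "y2 = snd (?d (0, 1) u)"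
  define K where "K = (\<lambda>v w. ?L (covariant_hessian U f u v w))"
  have dab: "fst (?d (a, b) u) = a *\<^sub>R x1 + b *\<^sub>R x2" "snd (?d (a, b) u) = a * y1 + b * y2" for a b
    using expand[OF lin[OF V(2)], of a b] by (simp_all add: x1_def x2_def y1_def y2_def)
  define m11 m12 m22 where "m11 = hyp_metric ?z x1 x1" and "m12 = hyp_metric ?z x1 x2"
    and "m22 = hyp_metric ?z x2 x2"
  have E: "first_form U f u (1, 0) (1, 0) = m11 + y1 * y1"
    and F: "first_form U f u (1, 0) (0, 1) = m12 + y1 * y2"
    and G: "first_form U f u (0, 1) (0, 1) = m22 + y2 * y2"
    by (simp_all add: first_form_def product_metric_def m11_def m12_def m22_def x1_def x2_def y1_def y2_def)
  have fu: "f u \<in> hyp_product" using fH u by auto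
  have nz: "?d v u \<noteq> 0" if "v \<noteq> 0" for v
    using inj that lin[OF V(2)] by (metis injD linear_0)
  have Epos: "m11 + y1 * y1 > 0"
    unfolding E[symmetric] first_form_def by (intro product_metric_pos fu nz) (simp add: zero_prod_def)
  let ?E = "m11 + y1 * y1" and ?F = "m12 + y1 * y2" and ?G = "m22 + y2 * y2"
  \<comment> \<open>This direction is orthogonal to the first coordinate vector; its squared length
    is \<open>?E\<close> times the Gram determinant, which is therefore positive.\<close>
  have "0 < first_form U f u (- ?F, ?E) (- ?F, ?E)"
    unfolding first_form_def by (intro product_metric_pos fu nz) (use Epos in \<open>auto simp: zero_prod_def\<close>)
  also have "\<dots> = ?E * (?E * ?G - ?F\<^sup>2)"
    unfolding first_form_def expand[OF lin[OF V(2)], of "- ?F" ?E] product_metric_linear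
      E[unfolded first_form_def] F[unfolded first_form_def] G[unfolded first_form_def]
      product_metric_commute[of _ "?d (0, 1) u" "?d (1, 0) u"]
    by (simp add: algebra_simps power2_eq_square)
  finally have Dpos: "?E * ?G - ?F\<^sup>2 > 0" using Epos by (simp add: zero_less_mult_iff)
  \<comment> \<open>The inequality is weak because the hyperbolic parts of the coordinate vectors
    are dependent when the tangent plane is vertical.\<close>
  have CS: "m12\<^sup>2 \<le> m11 * m22"
  proof -
    define k where "k = (2 / (1 - (norm ?z)\<^sup>2))\<^sup>2"
    have "k\<^sup>2 * (x1 \<bullet> x2)\<^sup>2 \<le> k\<^sup>2 * ((x1 \<bullet> x1) * (x2 \<bullet> x2))"
      by (intro mult_left_mono Cauchy_Schwarz_ineq) auto
    then show ?thesis
      unfolding m11_def m12_def m22_def hyp_metric_def k_def[symmetric]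
      by (simp add: power2_eq_square mult_ac)
  qed
  have "hyp_linear A B ?z \<le> 2 * c + 2 * c * \<bar>snd (f u) - n\<bar>"
  proof (rule trace_negative_semidefinite[OF \<open>c \<ge> 0\<close> Epos Dpos CS])
    \<comment> \<open>The Christoffel term split off here is the one that turns the Euclidean second
      derivative into \<open>covariant_hessian\<close>.\<close>
    have hess: "hyp_linear_deriv2 A B ?z x y =
        hyp_linear A B ?z * hyp_metric ?z x y + hyp_linear_deriv A B ?z (hyp_christoffel ?z x y)" for x y
      using hyp_linear_hessian[OF z, of A B x y] by simp
    have Keq: "K v w = ?L (?dd w v) + hyp_linear_deriv A B ?z (hyp_christoffel ?z (fst (?d v u)) (fst (?d w u)))" for v w
      by (simp add: K_def covariant_hessian_def test_deriv_linear product_christoffel_def)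
        (simp add: test_deriv_def)
    fix a b :: real
    have "hyp_linear_deriv2 A B ?z (a *\<^sub>R x1 + b *\<^sub>R x2) (a *\<^sub>R x1 + b *\<^sub>R x2) =
        a\<^sup>2 * hyp_linear_deriv2 A B ?z x1 x1 + 2 * a * b * hyp_linear_deriv2 A B ?z x1 x2 + b\<^sup>2 * hyp_linear_deriv2 A B ?z x2 x2"
      by (simp add: hyp_linear_deriv2_def inner_simps inner_commute add_divide_distrib algebra_simps power2_eq_square)
    then show "a\<^sup>2 * (hyp_linear A B ?z * m11 - 2 * c * (y1 * y1) + K (1, 0) (1, 0))
        + 2 * a * b * (hyp_linear A B ?z * m12 - 2 * c * (y1 * y2) + K (1, 0) (0, 1))
        + b\<^sup>2 * (hyp_linear A B ?z * m22 - 2 * c * (y2 * y2) + K (0, 1) (0, 1)) \<le> 0"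
      using line[of a b]
      by (simp add: dab test_deriv_linear Keq hess m11_def m12_def m22_def flip: x1_def x2_def)
        (simp add: algebra_simps power2_eq_square)
  next
    show "?G * K (1, 0) (1, 0) - 2 * ?F * K (1, 0) (0, 1) + ?E * K (0, 1) (0, 1) =
        (?E * ?G - ?F\<^sup>2) * (- 2 * c * (snd (f u) - n))"
      unfolding K_def E[symmetric] F[symmetric] G[symmetric]
    proof (rule translator_critical_point[OF fu _ tr])
      show "linear (frechet_derivative f (at u within U))" using lin[OF V(2)] .
      show "first_form U f u (1, 0) (1, 0) * first_form U f u (0, 1) (0, 1) - (first_form U f u (1, 0) (0, 1))\<^sup>2 \<noteq> 0"
        unfolding E F G using Dpos by simp
      show "?L (?d v u) = 0" for v using line[of "fst v" "snd v"] by simp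
    qed
  qed
  then show ?thesis .
qed

section \<open>Charts at the asymptotic curve\<close>

lemma surface_chartD:
  assumes "surface_chart X (U, \<phi>)"
  shows "openin (top_of_set half_plane) U" "openin X (\<phi> ` U)" "embedding_map (top_of_set U) X \<phi>"
    "continuous_map (top_of_set U) X \<phi>" "inj_on \<phi> U" "U \<subseteq> half_plane"
proof -
  show U: "openin (top_of_set half_plane) U" "openin X (\<phi> ` U)" "embedding_map (top_of_set U) X \<phi>"
    using assms by (auto simp: surface_chart_def embedding_map_def)
  have "homeomorphic_map (top_of_set U) (subtopology X (\<phi> ` U)) \<phi>"
    using assms by (simp add: surface_chart_def)
  then show "continuous_map (top_of_set U) X \<phi>" "inj_on \<phi> U"
    using homeomorphic_imp_continuous_map homeomorphic_imp_injective_map continuous_map_in_subtopology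
    by fastforce+
  show "U \<subseteq> half_plane" using U openin_imp_subset by blast
qed

lemma surface_chart_open_image:
  assumes "surface_chart X (U, \<phi>)" "openin (top_of_set U) V"
  shows "openin X (\<phi> ` V)"
proof -
  have "homeomorphic_map (top_of_set U) (subtopology X (\<phi> ` U)) \<phi>"
    using assms(1) by (simp add: surface_chart_def)
  then have "openin (subtopology X (\<phi> ` U)) (\<phi> ` V)"
    using assms(2) homeomorphic_imp_open_map by (auto simp: open_map_def)
  then show ?thesis using surface_chartD(2)[OF assms(1)] openin_trans_full by blast
qed

text \<open>Carries charts of the translator over to the enlarged surface, where they can be
  compared with boundary charts.\<close>

lemma surface_chart_compose_open:
  assumes "continuous_map X Y f" "open_map X Y f" "inj_on f (topspace X)" "surface_chart X (U, \<phi>)"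
  shows "surface_chart Y (U, f \<circ> \<phi>)"
proof -
  have "embedding_map X Y f" using assms by (simp add: injective_open_imp_embedding_map)
  then have "embedding_map (top_of_set U) Y (f \<circ> \<phi>)"
    using surface_chartD(3)[OF assms(4)] embedding_map_compose by blast
  then have "homeomorphic_map (top_of_set U) (subtopology Y ((f \<circ> \<phi>) ` U)) (f \<circ> \<phi>)"
    by (simp add: embedding_map_def)
  moreover have "openin Y ((f \<circ> \<phi>) ` U)"
    using assms(2) surface_chartD(2)[OF assms(4)] unfolding image_comp[symmetric] by (simp add: open_map_def)
  ultimately show ?thesis using surface_chartD(1)[OF assms(4)] by (simp add: surface_chart_def)
qed

text \<open>By invariance of domain the transition map sends a planar neighbourhood of
  \<open>u\<close> onto a planar neighbourhood of \<open>v\<close>, and the latter lies in the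
  half-plane.\<close>

lemma surface_chart_interior:
  assumes U: "surface_chart Y (U, \<phi>)" and V: "surface_chart Y (V, \<psi>)"
    and uv: "u \<in> U" "v \<in> V" "\<phi> u = \<psi> v" "snd u > 0"
  shows "snd v > 0"
proof -
  have "homeomorphic_map (top_of_set V) (subtopology Y (\<psi> ` V)) \<psi>"
    using V by (simp add: surface_chart_def)
  then obtain g where g: "homeomorphic_maps (top_of_set V) (subtopology Y (\<psi> ` V)) \<psi> g"
    using homeomorphic_map_maps by blast
  then have gc: "continuous_map (subtopology Y (\<psi> ` V)) (top_of_set V) g"
    and gl: "\<And>x. x \<in> V \<Longrightarrow> g (\<psi> x) = x"
    by (auto simp: homeomorphic_maps_def)
  define S where "S = {x \<in> U. \<phi> x \<in> \<psi> ` V} \<inter> {x. snd x > 0}"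
  have "openin (top_of_set U) {x \<in> U. \<phi> x \<in> \<psi> ` V}"
    using openin_continuous_map_preimage[OF surface_chartD(4)[OF U] surface_chartD(2)[OF V]] by simp
  then have "openin (top_of_set half_plane) {x \<in> U. \<phi> x \<in> \<psi> ` V}"
    using openin_trans surface_chartD(1)[OF U] by blast
  then have "open S" unfolding S_def by (rule open_Int_upper)
  moreover have cont: "continuous_on S (g \<circ> \<phi>)"
  proof -
    have "continuous_map (top_of_set S) Y \<phi>"
      using continuous_map_from_subtopology_mono[OF surface_chartD(4)[OF U], of S] by (auto simp: S_def)
    then have "continuous_map (top_of_set S) (subtopology Y (\<psi> ` V)) \<phi>"
      by (rule continuous_map_into_subtopology) (auto simp: S_def)
    from continuous_map_compose[OF this gc] show ?thesis by simp
  qed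
  moreover have "inj_on (g \<circ> \<phi>) S"
  proof (rule inj_onI)
    fix x y assume xy: "x \<in> S" "y \<in> S" "(g \<circ> \<phi>) x = (g \<circ> \<phi>) y"
    then have "\<phi> x = \<phi> y" by (auto simp: S_def gl)
    then show "x = y" using surface_chartD(5)[OF U] xy by (auto simp: S_def dest: inj_onD)
  qed
  ultimately have op: "open ((g \<circ> \<phi>) ` S)" by (intro invariance_of_domain)
  have "u \<in> S" using uv by (auto simp: S_def)
  moreover have "(g \<circ> \<phi>) u = v" using uv gl by simp
  ultimately have "v \<in> (g \<circ> \<phi>) ` S" by (metis imageI)
  with op obtain e where e: "e > 0" "ball v e \<subseteq> (g \<circ> \<phi>) ` S"
    using open_contains_ball by blast
  have "(g \<circ> \<phi>) ` S \<subseteq> half_plane"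
    using surface_chartD(6)[OF V] by (auto simp: S_def gl)
  \<comment> \<open>This point just below \<open>v\<close> would leave the half-plane if
    \<open>v\<close> were on the bounding line.\<close>
  moreover have "(fst v, snd v - e / 2) \<in> ball v e"
    using e(1) by (cases v) (simp add: dist_Pair_Pair dist_real_def)
  ultimately have "(fst v, snd v - e / 2) \<in> half_plane" using e by blast
  then show ?thesis using e(1) by (simp add: half_plane_def)
qed

lemma atLeastAtMost_Times_subset_ball:
  fixes a e :: real
  assumes "d > 0"
  shows "{a - d / 3..a + d / 3} \<times> {0..d / 3} \<subseteq> ball (a, 0) d \<inter> half_plane"
proof safe
  fix x y assume xy: "x \<in> {a - d / 3..a + d / 3}" "y \<in> {0..d / 3}"
  have "dist (a, 0) (x, y) \<le> dist a x + dist 0 y"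
    unfolding dist_Pair_Pair by (rule sqrt_sum_squares_le_sum) auto
  also have "\<dots> < d" using xy assms by (auto simp: dist_real_def)
  finally show "(x, y) \<in> ball (a, 0) d" by simp
  show "(x, y) \<in> half_plane" using xy by (simp add: half_plane_def)
qed

section \<open>The surface enlarged by its asymptotic curve\<close>

locale translator_asymptotic_curve =
  fixes X :: "'a topology" and \<A> :: "'a chart set" and F :: "'a \<Rightarrow> complex \<times> real" and s :: ereal
    and Y :: "('a + real) topology" and J :: "real set" and c :: "real \<Rightarrow> complex \<times> ereal"
    and F' :: "'a + real \<Rightarrow> complex \<times> ereal"
  assumes translator: "translator X \<A> F"
    and F_continuous: "continuous_map X (top_of_set hyp_product) F"
    and compact_boundary: "compactin X (surface_boundary X)"
    and s: "s = \<infinity> \<or> s = -\<infinity>"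
    and topspace_Y: "topspace Y = Inl ` topspace X \<union> Inr ` J"
    and Inl_continuous: "continuous_map X Y Inl" and Inl_open: "open_map X Y Inl"
    and J_boundary: "Inr ` J \<subseteq> surface_boundary Y"
    and F'_def: "F' = case_sum (to_compactification \<circ> F) c"
    and F'_continuous: "continuous_map Y euclidean F'"
    and c_image: "c ` J \<subseteq> hyp_plane \<times> {s}"
    and c_locally_inj: "\<And>j. j \<in> J \<Longrightarrow> \<exists>W. openin Y W \<and> Inr j \<in> W \<and> inj_on c {i\<in>J. Inr i \<in> W}"
begin

text \<open>The chart is taken from the atlas because the translator equation is stated in atlas
  charts.\<close>

lemma chart_over_interior:
  assumes "x \<in> topspace X" "x \<notin> surface_boundary X"
  obtains U \<phi> u where "(U, \<phi>) \<in> \<A>" "surface_chart X (U, \<phi>)" "u \<in> U" "\<phi> u = x" "snd u > 0"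
proof -
  have S: "\<forall>c\<in>\<A>. surface_chart X c" "topspace X = (\<Union>(U, \<phi>)\<in>\<A>. \<phi> ` U)"
    using translator by (auto simp: translator_def smooth_surface_def)
  then obtain U \<phi> u where U: "(U, \<phi>) \<in> \<A>" "u \<in> U" "\<phi> u = x" using assms(1) by auto
  then have ch: "surface_chart X (U, \<phi>)" using S by blast
  then have "snd u \<noteq> 0" using assms(2) U unfolding surface_boundary_def by blast
  moreover have "snd u \<ge> 0" using surface_chartD(6)[OF ch] U by (auto simp: half_plane_def)
  ultimately show ?thesis using that U ch by (metis less_le)
qed

lemma height_bounded_on_boundary: "\<exists>b. \<forall>x\<in>surface_boundary X. \<bar>snd (F x)\<bar> \<le> b"
proof -
  have "compactin (top_of_set hyp_product) (F ` surface_boundary X)"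
    by (rule image_compactin[OF compact_boundary F_continuous])
  then have "compact (F ` surface_boundary X)" by (simp add: compactin_subtopology)
  then have "compact (snd ` F ` surface_boundary X)"
    by (intro compact_continuous_image continuous_intros)
  then have "bounded (snd ` F ` surface_boundary X)" by (rule compact_imp_bounded)
  then obtain b where "\<forall>x\<in>snd ` F ` surface_boundary X. norm x \<le> b" by (auto simp: bounded_iff)
  then show ?thesis by auto
qed

text \<open>Some chart puts the point on the bounding line, and by invariance of domain no other
  chart can then put it above the line.\<close>

lemma chart_point_on_curve:
  assumes "surface_chart Y (U, \<phi>)" "u \<in> U" "\<phi> u = Inr i" "i \<in> J"
  shows "snd u = 0"
proof -
  have "Inr i \<in> surface_boundary Y" using J_boundary assms by blast
  then obtain V \<psi> v where "surface_chart Y (V, \<psi>)" "v \<in> V" "snd v = 0" "\<psi> v = Inr i"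
    by (auto simp: surface_boundary_def)
  then have "\<not> snd u > 0" using surface_chart_interior[OF assms(1), of V \<psi> u v] assms by auto
  moreover have "snd u \<ge> 0" using surface_chartD(6)[OF assms(1)] assms by (auto simp: half_plane_def)
  ultimately show ?thesis by simp
qed

text \<open>
  Heights are bounded on the compact boundary of X, so close to a point of the asymptotic curve a
  boundary chart of Y sees the curve on the bounding line and the interior of X above it.
\<close>

lemma boundary_rectangle:
  assumes "j \<in> J"
  obtains U \<phi> a e where "surface_chart Y (U, \<phi>)" "e > 0" "{a - e..a + e} \<times> {0..e} \<subseteq> U" "\<phi> (a, 0) = Inr j"
    "\<And>t. t \<in> {a - e..a + e} \<Longrightarrow> \<phi> (t, 0) \<in> Inr ` J"
    "\<And>p. p \<in> {a - e..a + e} \<times> {0<..e} \<Longrightarrow> \<exists>x\<in>topspace X - surface_boundary X. \<phi> p = Inl x"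
    "inj_on (\<lambda>t. F' (\<phi> (t, 0))) {a - e..a + e}"
proof -
  obtain W where W: "openin Y W" "Inr j \<in> W" "inj_on c {i\<in>J. Inr i \<in> W}"
    using c_locally_inj[OF assms] by blast
  obtain b where b: "\<forall>x\<in>surface_boundary X. \<bar>snd (F x)\<bar> \<le> b"
    using height_bounded_on_boundary by blast
  have "Inr j \<in> surface_boundary Y" using J_boundary assms by blast
  then obtain U \<phi> u where U: "surface_chart Y (U, \<phi>)" and u: "u \<in> U" "snd u = 0" "\<phi> u = Inr j"
    by (auto simp: surface_boundary_def)
  \<comment> \<open>Heights beyond the bound on the boundary of \<open>X\<close>; both infinite
    heights belong to \<open>H\<close>.\<close>
  define H where "H = {ereal b<..} \<union> {..<ereal (- b)}"
  have H: "open H" by (auto simp: H_def)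
  \<comment> \<open>\<open>W\<close> makes the curve injective and \<open>H\<close> keeps the
    boundary of \<open>X\<close> away.\<close>
  define P where "P = {p \<in> U. \<phi> p \<in> W} \<inter> {p \<in> U. F' (\<phi> p) \<in> UNIV \<times> H}"
  have \<phi>c: "continuous_map (top_of_set U) Y \<phi>" using surface_chartD(4)[OF U] .
  have "openin (top_of_set U) {p \<in> U. \<phi> p \<in> W}"
    using openin_continuous_map_preimage[OF \<phi>c W(1)] by simp
  moreover have "openin (top_of_set U) {p \<in> U. F' (\<phi> p) \<in> UNIV \<times> H}"
    using openin_continuous_map_preimage[OF continuous_map_compose[OF \<phi>c F'_continuous], of "UNIV \<times> H"] H
    by (simp add: open_Times)
  ultimately have "openin (top_of_set U) P" unfolding P_def by (rule openin_Int)
  then have "openin (top_of_set half_plane) P"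
    using openin_trans surface_chartD(1)[OF U] by blast
  moreover have "c j \<in> hyp_plane \<times> {s}" using c_image assms by auto
  then have "u \<in> P" using u W(2) s by (auto simp: P_def F'_def H_def)
  ultimately obtain d where d: "d > 0" "ball u d \<inter> half_plane \<subseteq> P"
    unfolding openin_contains_ball by blast
  define a where "a = fst u"
  have ua: "u = (a, 0)" using u by (simp add: a_def prod_eq_iff)
  define e where "e = d / 3"
  have rect: "{a - e..a + e} \<times> {0..e} \<subseteq> P"
    using atLeastAtMost_Times_subset_ball[OF d(1), of a] d(2) by (simp add: ua e_def) blast
  have inY: "\<phi> p \<in> topspace Y" if "p \<in> P" for p
    using that continuous_map_funspace[OF \<phi>c] by (auto simp: P_def)
  \<comment> \<open>The height shows that \<open>x\<close> is not a boundary point; an interior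
    chart of \<open>X\<close>, pushed into \<open>Y\<close>, then forces \<open>p\<close> above the
    bounding line.\<close>
  have left: "x \<notin> surface_boundary X \<and> snd p > 0" if "p \<in> P" "\<phi> p = Inl x" "x \<in> topspace X" for p x
  proof
    note xX = that(3)
    have "snd (F x) > b \<or> snd (F x) < - b" using that by (auto simp: P_def F'_def H_def to_compactification_def)
    then show x: "x \<notin> surface_boundary X" using b by force
    obtain V \<psi> v where V: "(V, \<psi>) \<in> \<A>" "surface_chart X (V, \<psi>)" "v \<in> V" "\<psi> v = x" "snd v > 0"
      by (rule chart_over_interior[OF xX x])
    have "surface_chart Y (V, Inl \<circ> \<psi>)"
      by (rule surface_chart_compose_open[OF Inl_continuous Inl_open _ V(2)]) simp
    from surface_chart_interior[OF this U V(3), of p] show "snd p > 0" using that V by (auto simp: P_def)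
  qed
  show ?thesis
  proof (rule that[OF U, of e a])
    show "e > 0" using d by (simp add: e_def)
    show "{a - e..a + e} \<times> {0..e} \<subseteq> U" using rect by (auto simp: P_def)
    show "\<phi> (a, 0) = Inr j" using u ua by simp
    \<comment> \<open>A point on the bounding line cannot come from \<open>X\<close>, since
      \<open>left\<close> would put it above the line.\<close>
    show bottom: "\<phi> (t, 0) \<in> Inr ` J" if "t \<in> {a - e..a + e}" for t
    proof -
      have P: "(t, 0) \<in> P" using that rect \<open>e > 0\<close> by auto
      show ?thesis using inY[OF P] left[OF P] unfolding topspace_Y by auto
    qed
    show "\<exists>x\<in>topspace X - surface_boundary X. \<phi> p = Inl x" if "p \<in> {a - e..a + e} \<times> {0<..e}" for p
    proof -
      have P: "p \<in> P" using that rect by (auto simp: subset_eq)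
      show ?thesis using inY[OF P] left[OF P] chart_point_on_curve[OF U, of p] that P
        unfolding topspace_Y by (auto simp: P_def)
    qed
    show "inj_on (\<lambda>t. F' (\<phi> (t, 0))) {a - e..a + e}"
    proof (rule inj_onI)
      fix t t' assume t: "t \<in> {a - e..a + e}" "t' \<in> {a - e..a + e}" "F' (\<phi> (t, 0)) = F' (\<phi> (t', 0))"
      obtain i i' where i: "i \<in> J" "\<phi> (t, 0) = Inr i" "i' \<in> J" "\<phi> (t', 0) = Inr i'"
        using bottom[OF t(1)] bottom[OF t(2)] by blast
      have P: "(t, 0) \<in> P" "(t', 0) \<in> P" using t rect \<open>e > 0\<close> by auto
      then have "Inr i \<in> W" "Inr i' \<in> W" using i by (auto simp: P_def)
      moreover have "c i = c i'" using t(3) i by (simp add: F'_def)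
      ultimately have "i = i'" using W(3) i by (auto dest: inj_onD)
      then have "\<phi> (t, 0) = \<phi> (t', 0)" using i by simp
      then show "t = t'" using surface_chartD(5)[OF U] P by (auto simp: P_def dest: inj_onD)
    qed
  qed
qed

text \<open>
  If the function were positive on the arc, then subtracting a small multiple of the squared distance
  from a suitable far height would give a test function with an interior maximum.
\<close>

lemma arc_comparison:
  assumes U: "surface_chart Y (U, \<phi>)" and "e > 0" and rect: "{l..r} \<times> {0..e} \<subseteq> U"
    and bottom: "\<And>t. t \<in> {l..r} \<Longrightarrow> \<phi> (t, 0) \<in> Inr ` J"
    and upper: "\<And>p. p \<in> {l..r} \<times> {0<..e} \<Longrightarrow> \<exists>x\<in>topspace X - surface_boundary X. \<phi> p = Inl x"
    and ends: "hyp_linear A B (fst (F' (\<phi> (l, 0)))) \<le> 0" "hyp_linear A B (fst (F' (\<phi> (r, 0)))) \<le> 0"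
    and t: "t \<in> {l..r}"
  shows "hyp_linear A B (fst (F' (\<phi> (t, 0)))) \<le> 0"
proof (rule ccontr)
  define x h w where "x = (\<lambda>p. fst (F' (\<phi> p)))" and "h = (\<lambda>p. snd (F' (\<phi> p)))"
    and "w = (\<lambda>p. hyp_linear A B (fst (F' (\<phi> p))))"
  \<comment> \<open>On the bottom edge the height is infinite and \<open>real_of_ereal\<close>
    returns its default 0, so \<open>y\<close> is the true height only above that edge.\<close>
  define y where "y = (\<lambda>p. real_of_ereal (h p))"
  define m where "m = w (t, 0)"
  assume "\<not> ?thesis"
  then have m: "m > 0" by (simp add: m_def w_def)
  have F_hyp: "F z \<in> hyp_product" if "z \<in> topspace X" for z
    using continuous_map_funspace[OF F_continuous] that by auto
  have below: "x p \<in> hyp_plane" "h p = s" if "p \<in> {l..r} \<times> {0}" for p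
    using bottom[of "fst p"] that subsetD[OF c_image imageI]
    by (cases p; auto simp: x_def h_def F'_def mem_Times_iff)+
  have above: "x p \<in> hyp_plane" "h p = ereal (y p)" if "p \<in> {l..r} \<times> {0<..e}" for p
    using upper[OF that] F_hyp
    by (auto simp: x_def h_def y_def F'_def to_compactification_def hyp_product_def mem_Times_iff)
  have split: "p \<in> {l..r} \<times> {0} \<or> p \<in> {l..r} \<times> {0<..e}" if "p \<in> {l..r} \<times> {0..e}" for p
    using that by force
  have x_hyp: "x p \<in> hyp_plane" if "p \<in> {l..r} \<times> {0..e}" for p
    using split[OF that] below above by blast
  have "continuous_on U (F' \<circ> \<phi>)"
    using continuous_map_compose[OF surface_chartD(4)[OF U] F'_continuous] by simp
  then have F\<phi>: "continuous_on ({l..r} \<times> {0..e}) (\<lambda>p. F' (\<phi> p))"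
    using continuous_on_subset[OF _ rect] by (auto simp: o_def)
  then have cont: "continuous_on ({l..r} \<times> {0..e}) x" "continuous_on ({l..r} \<times> {0..e}) h"
    unfolding x_def h_def by (intro continuous_intros; assumption)+
  have contw: "continuous_on ({l..r} \<times> {0..e}) w"
  proof -
    have "1 - x p \<bullet> x p \<noteq> 0" if "p \<in> {l..r} \<times> {0..e}" for p
      using hyp_plane_inner[OF x_hyp[OF that]] by simp
    then have "continuous_on ({l..r} \<times> {0..e}) (\<lambda>p. hyp_linear A B (x p))"
      unfolding hyp_linear_def by (intro continuous_intros cont) auto
    then show ?thesis by (simp add: w_def x_def)
  qed
  have near: "\<exists>\<eta>>0. \<eta> \<le> e \<and> (\<forall>\<tau>\<in>{0..\<eta>}. g (k, \<tau>) \<in> H)"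
    if "continuous_on ({l..r} \<times> {0..e}) g" "open H" "g (k, 0) \<in> H" "k \<in> {l..r}"
    for g :: "real \<times> real \<Rightarrow> 'c::topological_space" and H k
  proof -
    have "continuous_on {0..e} (\<lambda>\<tau>. g (k, \<tau>))"
      by (rule continuous_on_compose2[OF that(1)]) (use that(4) in \<open>auto intro!: continuous_intros\<close>)
    then have "openin (top_of_set {0..e}) ({0..e} \<inter> (\<lambda>\<tau>. g (k, \<tau>)) -` H)"
      using that(2) by (rule continuous_openin_preimage_gen)
    moreover have "0 \<in> {0..e} \<inter> (\<lambda>\<tau>. g (k, \<tau>)) -` H" using that(3) \<open>e > 0\<close> by simp
    ultimately obtain d where d: "d > 0" "ball 0 d \<inter> {0..e} \<subseteq> (\<lambda>\<tau>. g (k, \<tau>)) -` H"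
      unfolding openin_contains_ball by blast
    show ?thesis
      by (rule exI[of _ "min (d / 2) e"]) (use d \<open>e > 0\<close> in \<open>auto simp: subset_eq\<close>)
  qed
  have lr: "l \<in> {l..r}" "r \<in> {l..r}" using t by auto
  have wl: "w (l, 0) \<in> {..<m / 2}" and wr: "w (r, 0) \<in> {..<m / 2}" and wt: "w (t, 0) \<in> {m / 2<..}"
    using ends m by (auto simp: w_def m_def)
  obtain \<eta>1 where \<eta>1: "\<eta>1 > 0" "\<eta>1 \<le> e" "\<forall>\<tau>\<in>{0..\<eta>1}. w (l, \<tau>) \<in> {..<m / 2}"
    using near[OF contw _ wl lr(1)] by auto
  obtain \<eta>2 where \<eta>2: "\<eta>2 > 0" "\<eta>2 \<le> e" "\<forall>\<tau>\<in>{0..\<eta>2}. w (r, \<tau>) \<in> {..<m / 2}"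
    using near[OF contw _ wr lr(2)] by auto
  obtain \<eta>3 where \<eta>3: "\<eta>3 > 0" "\<eta>3 \<le> e" "\<forall>\<tau>\<in>{0..\<eta>3}. w (t, \<tau>) \<in> {m / 2<..}"
    using near[OF contw _ wt t] by auto
  \<comment> \<open>On a rectangle of this height \<open>w\<close> stays below m/2 on the lateral
    sides and above m/2 over \<open>t\<close>, so a maximum exceeding m/2 avoids those
    sides.\<close>
  define \<eta> where "\<eta> = min \<eta>1 (min \<eta>2 \<eta>3)"
  have \<eta>: "\<eta> > 0" "\<eta> \<le> e" using \<eta>1 \<eta>2 \<eta>3 by (auto simp: \<eta>_def)
  have sides: "w (l, \<tau>) < m / 2" "w (r, \<tau>) < m / 2" "w (t, \<tau>) > m / 2" if "\<tau> \<in> {0..\<eta>}" for \<tau>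
    using \<eta>1(3) \<eta>2(3) \<eta>3(3) that by (auto simp: \<eta>_def)
  define R where "R = {l..r} \<times> {0..\<eta>}"
  have R: "compact R" "R \<subseteq> {l..r} \<times> {0..e}" using \<eta> by (auto simp: R_def intro: compact_Times)
  have "bounded (w ` R)"
    using compact_continuous_image[OF continuous_on_subset[OF contw R(2)] R(1)] by (rule compact_imp_bounded)
  then obtain b where b: "\<And>p. p \<in> R \<Longrightarrow> \<bar>w p\<bar> \<le> b" unfolding bounded_iff by auto
  have conty: "continuous_on S y" if "S \<subseteq> {l..r} \<times> {0<..e}" for S
  proof -
    have "continuous_on S h" using continuous_on_subset[OF cont(2), of S] that by force
    moreover have "h ` S \<subseteq> UNIV - {\<infinity>, -\<infinity>}" using above(2) that by force
    ultimately show ?thesis unfolding y_def by (rule continuous_on_compose2[OF continuous_on_real])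
  qed
  have "compact (y ` ({l..r} \<times> {\<eta>}))"
    by (intro compact_continuous_image conty compact_Times) (use \<eta> in auto)
  then have "bounded (y ` ({l..r} \<times> {\<eta>}))" by (rule compact_imp_bounded)
  then obtain b' where "\<forall>v\<in>y ` ({l..r} \<times> {\<eta>}). norm v \<le> b'" unfolding bounded_iff by blast
  then have b': "\<bar>y (k, \<eta>)\<bar> \<le> b'" if "k \<in> {l..r}" for k using that by auto
  \<comment> \<open>The eighth turns the level m/2 into \<open>4 * k0\<close>, which is what the
    final quadratic inequality requires.\<close>
  define k0 where "k0 = m / 8"
  \<comment> \<open>From vertical distance \<open>D\<close> on, the penalty exceeds the bound
    \<open>b\<close> of \<open>w\<close>: since \<open>D\<close> is at least 1, k0 D^2 >= k0 D = k0
    + |b|.\<close>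
  define D where "D = 1 + \<bar>b\<bar> / k0"
  have k0: "k0 > 0" using m by (simp add: k0_def)
  have D: "b < k0 * d\<^sup>2" if "D \<le> \<bar>d\<bar>" for d
  proof -
    have "1 \<le> D" using k0 by (simp add: D_def)
    have "k0 * D = k0 + \<bar>b\<bar>" using k0 by (simp add: D_def distrib_left)
    then have "b < k0 * D" using k0 by linarith
    also have "\<dots> \<le> k0 * (\<bar>d\<bar> * \<bar>d\<bar>)"
      using that \<open>1 \<le> D\<close> k0 mult_mono[of 1 "\<bar>d\<bar>" D "\<bar>d\<bar>"] by (intro mult_left_mono) auto
    finally show ?thesis by (simp add: power2_eq_square)
  qed
  have Dpos: "D > 0" using k0 by (simp add: D_def add_pos_nonneg)
  \<comment> \<open>Heights farther than \<open>D\<close> from every height that occurs on the top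
    edge.\<close>
  define H where "H = {ereal (b' + D)<..} \<union> {..<ereal (- (b' + D))}"
  have H: "open H" "h (t, 0) \<in> H"
    using below(2)[of "(t, 0)"] s t by (auto simp: H_def)
  obtain \<tau>1 where \<tau>1: "\<tau>1 > 0" "\<tau>1 \<le> e" "\<forall>\<tau>\<in>{0..\<tau>1}. h (t, \<tau>) \<in> H"
    using near[OF cont(2) H t] by blast
  define \<tau>0 where "\<tau>0 = min \<tau>1 \<eta>"
  have \<tau>0: "0 < \<tau>0" "\<tau>0 \<le> \<eta>" "h (t, \<tau>0) \<in> H" using \<tau>1 \<eta> by (auto simp: \<tau>0_def)
  \<comment> \<open>Centring the penalty at a height attained over \<open>t\<close> makes it vanish
    at that point, where the test function is therefore above m/2.\<close>
  define n where "n = y (t, \<tau>0)"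
  have htn: "h (t, \<tau>0) = ereal n" using above(2)[of "(t, \<tau>0)"] t \<tau>0 \<eta> by (simp add: n_def)
  then have n: "\<bar>n\<bar> > b' + D" using \<tau>0(3) by (auto simp: H_def)
  define \<Phi> where "\<Phi> = (\<lambda>p. w p - k0 * (y p - n)\<^sup>2)"
  have far: "\<Phi> p < 0" if "p \<in> R" "D \<le> \<bar>y p - n\<bar>" for p
    using b[OF that(1)] D[OF that(2)] by (simp add: \<Phi>_def)
  \<comment> \<open>Cutting the heights at \<open>M\<close> removes the bottom edge and leaves a
    compact set. Points removed at finite height are farther than \<open>D\<close> from
    \<open>n\<close>, so the test function is negative there.\<close>
  define M where "M = \<bar>n\<bar> + D"
  define K where "K = R \<inter> h -` {ereal (- M)..ereal M}"
  have K_finite: "p \<in> {l..r} \<times> {0<..e}" if "p \<in> K" for p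
  proof -
    have "h p \<noteq> s" using that s by (auto simp: K_def)
    then show ?thesis using split[of p] below(2)[of p] that R(2) by (auto simp: K_def)
  qed
  have "compact K"
  proof -
    have "closedin (top_of_set R) K"
      unfolding K_def by (rule continuous_closedin_preimage[OF continuous_on_subset[OF cont(2) R(2)]]) auto
    then show ?thesis using R(1) closedin_compact by blast
  qed
  moreover have "(t, \<tau>0) \<in> K" using htn t \<tau>0 Dpos by (auto simp: K_def R_def M_def)
  moreover have "continuous_on K \<Phi>"
    unfolding \<Phi>_def using K_finite
    by (intro continuous_intros continuous_on_subset[OF contw] conty) force+
  ultimately obtain q where q: "q \<in> K" "\<And>p. p \<in> K \<Longrightarrow> \<Phi> p \<le> \<Phi> q"
    using continuous_attains_sup[of K \<Phi>] by blast
  have "\<Phi> (t, \<tau>0) > m / 2" using sides(3)[of \<tau>0] \<tau>0 by (simp add: \<Phi>_def n_def)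
  then have q_large: "\<Phi> q > m / 2" using q \<open>(t, \<tau>0) \<in> K\<close> by force
  define V where "V = {l<..<r} \<times> {0<..<\<eta>}"
  have "open V" by (simp add: V_def open_Times)
  have VR: "V \<subseteq> R" by (auto simp: V_def R_def)
  have max: "\<Phi> p \<le> \<Phi> q" if "p \<in> V" for p
  proof (cases "p \<in> K")
    case False
    have "p \<in> R" using that VR by blast
    moreover have "h p = ereal (y p)" using above(2)[of p] that \<eta> by (auto simp: V_def)
    ultimately have "\<bar>y p\<bar> > M" using False by (auto simp: K_def)
    then have "\<Phi> p < 0" using far[OF \<open>p \<in> R\<close>] by (auto simp: M_def)
    then show ?thesis using q_large m by simp
  qed (use q in auto)
  \<comment> \<open>The lateral sides are excluded by the size of \<open>w\<close>, the top edge by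
    its distance from \<open>n\<close>, and the bottom edge by the finite height.\<close>
  have "q \<in> V"
  proof -
    obtain k \<tau> where q_eq: "q = (k, \<tau>)" by fastforce
    have qR: "k \<in> {l..r}" "\<tau> \<in> {0<..\<eta>}" using q(1) K_finite[OF q(1)] by (auto simp: K_def R_def q_eq)
    have "k0 * (y q - n)\<^sup>2 \<ge> 0" using k0 by simp
    then have "w q > m / 2" using q_large unfolding \<Phi>_def by linarith
    then have "k \<noteq> l" "k \<noteq> r" using sides[of \<tau>] qR by (auto simp: q_eq)
    moreover have "\<tau> \<noteq> \<eta>"
    proof
      assume "\<tau> = \<eta>"
      then have "\<bar>y q\<bar> \<le> b'" using b' qR by (simp add: q_eq)
      then have "\<Phi> q < 0" using far[of q] q(1) n by (auto simp: K_def)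
      then show False using q_large m by simp
    qed
    ultimately show ?thesis using qR by (auto simp: q_eq V_def)
  qed
  obtain z where z: "z \<in> topspace X" "z \<notin> surface_boundary X" "\<phi> q = Inl z"
    using upper[of q] K_finite[OF q(1)] by blast
  obtain T \<psi> v where T: "(T, \<psi>) \<in> \<A>" "surface_chart X (T, \<psi>)" "v \<in> T" "\<psi> v = z" "snd v > 0"
    by (rule chart_over_interior[OF z(1,2)])
  have "openin Y (\<phi> ` V)"
    by (rule surface_chart_open_image[OF U]) (use \<open>open V\<close> VR R(2) rect in \<open>auto intro!: open_subset\<close>)
  moreover have "continuous_map (top_of_set T) Y (Inl \<circ> \<psi>)"
    using continuous_map_compose[OF surface_chartD(4)[OF T(2)] Inl_continuous] .
  ultimately have "openin (top_of_set T) {u \<in> T. Inl (\<psi> u) \<in> \<phi> ` V}"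
    using openin_continuous_map_preimage by force
  then have "openin (top_of_set half_plane) {u \<in> T. Inl (\<psi> u) \<in> \<phi> ` V}"
    using openin_trans surface_chartD(1)[OF T(2)] by blast
  then have open_nbhd: "open ({u \<in> T. Inl (\<psi> u) \<in> \<phi> ` V} \<inter> {u. snd u > 0})" by (rule open_Int_upper)
  have \<Phi>_eq: "\<Phi> p = hyp_linear A B (fst (F (\<psi> u))) - k0 * (snd (F (\<psi> u)) - n)\<^sup>2"
    "w p = hyp_linear A B (fst (F (\<psi> u)))" "y p = snd (F (\<psi> u))"
    if "\<phi> p = Inl (\<psi> u)" for p u
    using that by (simp_all add: \<Phi>_def w_def y_def h_def F'_def to_compactification_def)
  have q_eq: "\<phi> q = Inl (\<psi> v)" using z T by simp
  have "hyp_linear A B (fst ((F \<circ> \<psi>) v)) \<le> 2 * k0 + 2 * k0 * \<bar>snd ((F \<circ> \<psi>) v) - n\<bar>"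
  proof (rule test_function_max[OF surface_chartD(1)[OF T(2)] _ T(3,5) _ _ _ _ open_nbhd])
    have imm: "smooth_map_on T (F \<circ> \<psi>)" "\<forall>u\<in>T. inj (frechet_derivative (F \<circ> \<psi>) (at u within T))"
      using translator T(1) by (auto simp: translator_def smooth_immersion_def)
    show "smooth_map_on T (F \<circ> \<psi>)" "inj (frechet_derivative (F \<circ> \<psi>) (at v within T))"
      using imm T(3) by blast+
    show "(F \<circ> \<psi>) ` T \<subseteq> hyp_product"
      using F_hyp funcset_mem[OF continuous_map_funspace[OF surface_chartD(4)[OF T(2)]]]
      by (intro image_subsetI) simp
    show "mean_curvature T (F \<circ> \<psi>) v N = product_metric ((F \<circ> \<psi>) v) N vertical_field"
      if "unit_normal T (F \<circ> \<psi>) v N" for N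
      using translator T(1,3) that unfolding translator_def comp_apply by blast
    show "0 \<le> k0" using k0 by simp
    show "v \<in> {u \<in> T. Inl (\<psi> u) \<in> \<phi> ` V} \<inter> {u. snd u > 0}"
      using T q_eq \<open>q \<in> V\<close> by (auto simp: image_iff intro!: bexI[of _ q])
    show "{u \<in> T. Inl (\<psi> u) \<in> \<phi> ` V} \<inter> {u. snd u > 0} \<subseteq> T" by auto
    fix u assume "u \<in> {u \<in> T. Inl (\<psi> u) \<in> \<phi> ` V} \<inter> {u. snd u > 0}"
    then obtain p where "p \<in> V" "\<phi> p = Inl (\<psi> u)" by auto
    then show "hyp_linear A B (fst ((F \<circ> \<psi>) u)) - k0 * (snd ((F \<circ> \<psi>) u) - n)\<^sup>2
        \<le> hyp_linear A B (fst ((F \<circ> \<psi>) v)) - k0 * (snd ((F \<circ> \<psi>) v) - n)\<^sup>2"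
      using max[of p] \<Phi>_eq(1)[of p u] \<Phi>_eq(1)[OF q_eq] by simp
  qed
  then have "w q \<le> 2 * k0 + 2 * k0 * \<bar>y q - n\<bar>" using \<Phi>_eq(2,3)[OF q_eq] by simp
  moreover have "w q > 4 * k0 + k0 * \<bar>y q - n\<bar>\<^sup>2" using q_large by (simp add: \<Phi>_def k0_def)
  \<comment> \<open>With d the vertical distance to \<open>n\<close>, the two bounds for
    \<open>w q\<close> would give 4 + d^2 < 2 + 2d, that is (d - 1)^2 + 1 < 0.\<close>
  moreover have "k0 * ((\<bar>y q - n\<bar> - 1)\<^sup>2 + 1) > 0" using k0 by (simp add: add_nonneg_pos)
  ultimately show False by (simp add: power2_eq_square algebra_simps)
qed

end

section \<open>Geodesics in the Klein model\<close>

text \<open>The passage from the Poincare disc to the Klein disc, where geodesics are chords: the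
  quotient (X1, X2) / X0 of the hyperboloid coordinates.\<close>

definition klein :: "complex \<Rightarrow> complex" where
  "klein z = (2 / (1 + z \<bullet> z)) *\<^sub>R z"

lemma one_plus_inner_pos: "1 + z \<bullet> (z :: complex) > 0"
  by (simp add: add_pos_nonneg)

text \<open>Dividing by the positive coordinate X0 = (1 + |z|^2) / (1 - |z|^2) leaves an affine
  function on the Klein disc.\<close>

lemma hyp_linear_le_0_iff:
  assumes "z \<in> hyp_plane"
  shows "hyp_linear A B z \<le> 0 \<longleftrightarrow> A + B \<bullet> klein z \<le> 0"
proof -
  have "A * (1 + z \<bullet> z) + 2 * (B \<bullet> z) = (1 + z \<bullet> z) * (A + B \<bullet> klein z)"
    using one_plus_inner_pos[of z] by (simp add: klein_def field_simps)
  then have "hyp_linear A B z = (1 + z \<bullet> z) * (A + B \<bullet> klein z) / (1 - z \<bullet> z)"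
    by (simp add: hyp_linear_def)
  then show ?thesis
    using hyp_plane_inner[OF assms] one_plus_inner_pos[of z]
    by (simp add: divide_le_0_iff mult_le_0_iff)
qed

lemma continuous_on_klein: "continuous_on S klein"
  unfolding klein_def using one_plus_inner_pos by (intro continuous_intros) (metis less_irrefl)

lemma inner_klein:
  assumes "z \<in> hyp_plane"
  shows "1 - klein z \<bullet> klein z = ((1 - z \<bullet> z) / (1 + z \<bullet> z))\<^sup>2"
proof -
  define q where "q = z \<bullet> z"
  have q: "1 + q > 0" using one_plus_inner_pos[of z] by (simp add: q_def)
  have "klein z \<bullet> klein z = 4 * q / (1 + q)\<^sup>2"
    by (simp add: klein_def q_def power2_eq_square)
  also have "1 - \<dots> = ((1 - q) / (1 + q))\<^sup>2"
    using q by (simp add: divide_simps) (simp add: power2_eq_square algebra_simps)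
  finally show ?thesis by (simp add: q_def)
qed

lemma klein_inner_less_1:
  assumes "z \<in> hyp_plane"
  shows "klein z \<bullet> klein z < 1"
proof -
  have "((1 - z \<bullet> z) / (1 + z \<bullet> z))\<^sup>2 > 0"
    using hyp_plane_inner[OF assms] one_plus_inner_pos[of z] by simp
  then show ?thesis using inner_klein[OF assms] by linarith
qed

text \<open>The inverse sends k to k / (1 + sqrt (1 - |k|^2)), by
  \<open>inner_klein\<close>.\<close>

lemma klein_inj_on: "inj_on klein hyp_plane"
proof (rule inj_onI)
  have inverse: "z = (1 / (1 + sqrt (1 - klein z \<bullet> klein z))) *\<^sub>R klein z" if "z \<in> hyp_plane" for z
  proof -
    have "sqrt (1 - klein z \<bullet> klein z) = (1 - z \<bullet> z) / (1 + z \<bullet> z)"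
      using hyp_plane_inner[OF that] one_plus_inner_pos[of z] by (simp add: inner_klein[OF that])
    then have eq: "1 + sqrt (1 - klein z \<bullet> klein z) = 2 / (1 + z \<bullet> z)"
      using one_plus_inner_pos[of z] by (simp add: field_simps)
    have cancel: "1 / k * k = 1" if "k \<noteq> 0" for k :: real using that by simp
    have coeff: "1 / (2 / (1 + z \<bullet> z)) * (2 / (1 + z \<bullet> z)) = 1"
      by (rule cancel) (use one_plus_inner_pos[of z] in auto)
    show ?thesis unfolding eq unfolding klein_def scaleR_scaleR coeff by simp
  qed
  fix z z' assume "z \<in> hyp_plane" "z' \<in> hyp_plane" "klein z = klein z'"
  then show "z = z'" using inverse[of z] inverse[of z'] by simp
qed

section \<open>Chords of the Klein disc as complete geodesics\<close>

lemma tanh_real_surj: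
  assumes "\<bar>x :: real\<bar> < 1"
  shows "\<exists>t. tanh t = x"
proof
  define q where "q = (1 + x) / (1 - x)"
  have "q > 0" using assms by (simp add: q_def)
  then have "tanh (ln (sqrt q)) = (q - 1) / (q + 1)" by (simp add: tanh_ln_real)
  also have "\<dots> = x" using assms by (simp add: q_def divide_simps)
  finally show "tanh (ln (sqrt ((1 + x) / (1 - x)))) = x" by (simp add: q_def)
qed

lemma complete_hyp_geodesic_chord:
  assumes n: "n \<bullet> n = 1" "\<tau> \<bullet> \<tau> = 1" "n \<bullet> \<tau> = 0" and "\<bar>\<delta>\<bar> < 1"
  shows "complete_hyp_geodesic {z \<in> hyp_plane. \<exists>k. klein z = \<delta> *\<^sub>R n + k *\<^sub>R \<tau>}"
proof -
  \<comment> \<open>On the hyperboloid the geodesic has X0 = C cosh t and spatial part (S cosh t) n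
    + (sinh t) \<tau>, with C^2 - S^2 = 1. The Poincare disc divides the spatial part by
    \<open>D\<close> = 1 + X0, which gives \<open>c\<close>; the Klein disc divides it by X0, whence
    \<delta> = S / C.\<close>
  define C where "C = 1 / sqrt (1 - \<delta>\<^sup>2)"
  have \<delta>: "1 - \<delta>\<^sup>2 > 0" using assms(4) by (simp add: abs_square_less_1)
  have C: "C > 0" "C * C * (1 - \<delta> * \<delta>) = 1"
    using \<delta> by (auto simp: C_def power2_eq_square)
  define S where "S = \<delta> * C"
  have SC: "S * S = C * C - 1" using C(2) by (simp add: S_def algebra_simps)
  define D where "D = (\<lambda>t. 1 + C * cosh t)"
  have D: "D t > 0" for t using C(1) by (simp add: D_def add_pos_pos)
  have cs: "cosh t * cosh t = sinh t * sinh t + 1" for t :: real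
    using cosh_square_eq[of t] by (simp add: power2_eq_square)
  have lin: "(a *\<^sub>R n + b *\<^sub>R \<tau>) \<bullet> (a' *\<^sub>R n + b' *\<^sub>R \<tau>) = a * a' + b * b'" for a b a' b'
    using n by (simp add: inner_simps inner_commute)
  define c where "c = (\<lambda>t. (S * cosh t / D t) *\<^sub>R n + (sinh t / D t) *\<^sub>R \<tau>)"
  define c' where "c' = (\<lambda>t. (S * sinh t / (D t)\<^sup>2) *\<^sub>R n + ((cosh t + C) / (D t)\<^sup>2) *\<^sub>R \<tau>)"
  define c'' where "c'' = (\<lambda>t. (S * cosh t / (D t)\<^sup>2 - 2 * C * sinh t * (S * sinh t) / (D t) ^ 3) *\<^sub>R n
    + (sinh t / (D t)\<^sup>2 - 2 * C * sinh t * (cosh t + C) / (D t) ^ 3) *\<^sub>R \<tau>)"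
  have DD: "(D has_real_derivative C * sinh t) (at t)" for t
    unfolding D_def by (auto intro!: derivative_eq_intros)
  have deriv: "(c has_vector_derivative c' t) (at t)" for t
  proof -
    have "((\<lambda>t. S * cosh t / D t) has_real_derivative S * sinh t / (D t)\<^sup>2) (at t)"
      using D[of t] by (auto intro!: derivative_eq_intros DD)
        (simp add: D_def power2_eq_square divide_simps, simp add: algebra_simps)
    moreover have "((\<lambda>t. sinh t / D t) has_real_derivative (cosh t + C) / (D t)\<^sup>2) (at t)"
      using D[of t] by (auto intro!: derivative_eq_intros DD)
        (simp add: D_def power2_eq_square divide_simps, simp add: algebra_simps cs)
    ultimately show ?thesis
      unfolding c_def c'_def has_real_derivative_iff_has_vector_derivative
      by (intro has_vector_derivative_add bounded_linear.has_vector_derivative[OF bounded_linear_scaleR_left])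
  qed
  have deriv2: "(c' has_vector_derivative c'' t) (at t)" for t
  proof -
    have "((\<lambda>t. S * sinh t / (D t)\<^sup>2) has_real_derivative
        S * cosh t / (D t)\<^sup>2 - 2 * C * sinh t * (S * sinh t) / (D t) ^ 3) (at t)"
      using D[of t] by (auto intro!: derivative_eq_intros DD)
        (simp add: eval_nat_numeral divide_simps, simp add: algebra_simps)
    moreover have "((\<lambda>t. (cosh t + C) / (D t)\<^sup>2) has_real_derivative
        sinh t / (D t)\<^sup>2 - 2 * C * sinh t * (cosh t + C) / (D t) ^ 3) (at t)"
      using D[of t] by (auto intro!: derivative_eq_intros DD)
        (simp add: eval_nat_numeral divide_simps, simp add: algebra_simps)
    ultimately show ?thesis
      unfolding c'_def c''_def has_real_derivative_iff_has_vector_derivative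
      by (intro has_vector_derivative_add bounded_linear.has_vector_derivative[OF bounded_linear_scaleR_left])
  qed
  \<comment> \<open>Equivalently, \<open>D t\<close> is 2 / (1 - |c t|^2), the factor that occurs in
    the metric and in the Christoffel term.\<close>
  have cc: "c t \<bullet> c t = 1 - 2 / D t" for t
  proof -
    have "S * cosh t * (S * cosh t) + sinh t * sinh t = (S * S) * (cosh t * cosh t) + sinh t * sinh t"
      by (simp add: algebra_simps)
    also have "\<dots> = D t * D t - 2 * D t"
      unfolding SC by (simp add: D_def cs algebra_simps)
    finally have "c t \<bullet> c t = (D t * D t - 2 * D t) / (D t * D t)"
      unfolding c_def lin by (simp flip: add_divide_distrib)
    then show ?thesis using D[of t] by (simp add: diff_divide_distrib)
  qed
  have c'c': "c' t \<bullet> c' t = 1 / (D t)\<^sup>2" for t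
  proof -
    have "S * sinh t * (S * sinh t) + (cosh t + C) * (cosh t + C) =
        (S * S) * (sinh t * sinh t) + (cosh t + C) * (cosh t + C)"
      by (simp add: algebra_simps)
    also have "\<dots> = D t * D t"
      unfolding SC by (simp add: D_def cs algebra_simps)
    finally have "c' t \<bullet> c' t = (D t * D t) / ((D t)\<^sup>2 * (D t)\<^sup>2)"
      unfolding c'_def lin by (simp flip: add_divide_distrib)
    then show ?thesis using D[of t] by (simp add: field_simps power2_eq_square)
  qed
  have cc': "c t \<bullet> c' t = C * sinh t / (D t)\<^sup>2" for t
  proof -
    have "S * cosh t * (S * sinh t) + sinh t * (cosh t + C) =
        (S * S) * (cosh t * sinh t) + sinh t * (cosh t + C)"
      by (simp add: algebra_simps)
    also have "\<dots> = C * sinh t * D t"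
      unfolding SC by (simp add: D_def algebra_simps)
    finally have "c t \<bullet> c' t = (C * sinh t * D t) / (D t * (D t)\<^sup>2)"
      unfolding c_def c'_def lin by (simp flip: add_divide_distrib)
    then show ?thesis using D[of t] by (simp add: field_simps power2_eq_square)
  qed
  have hyp: "c t \<in> hyp_plane" for t
  proof -
    have "c t \<bullet> c t < 1" using D[of t] by (simp add: cc)
    then show ?thesis by (simp add: hyp_plane_def abs_square_less_1 flip: power2_norm_eq_inner)
  qed
  have conf: "2 / (1 - (norm (c t))\<^sup>2) = D t" for t
    using D[of t] by (simp add: power2_norm_eq_inner cc)
  have unit: "hyp_metric (c t) (c' t) (c' t) = 1" for t
    using D[of t] by (simp add: hyp_metric_def conf c'c')
  have geodesic: "c'' t = - hyp_christoffel (c t) (c' t) (c' t)" for t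
  proof -
    have "hyp_christoffel (c t) (c' t) (c' t) = (2 * C * sinh t / D t) *\<^sub>R c' t - (1 / D t) *\<^sub>R c t"
      using D[of t] unfolding hyp_christoffel_def conf cc' c'c'
      by (simp add: scaleR_diff_right scaleR_add_right power2_eq_square flip: scaleR_add_left)
    then show ?thesis
      unfolding c_def c'_def c''_def
      by (simp add: scaleR_add_right scaleR_diff_left eval_nat_numeral mult_ac)
  qed
  have klein_c: "klein (c t) = \<delta> *\<^sub>R n + (tanh t / C) *\<^sub>R \<tau>" for t
  proof -
    have "1 + c t \<bullet> c t = 2 * (D t - 1) / D t" using D[of t] by (simp add: cc field_simps)
    moreover have "2 / (2 * x / y) = y / x" for x y :: real by simp
    from this[of "D t - 1" "D t"] have "2 / (2 * (D t - 1) / D t) = D t / (D t - 1)" .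
    ultimately have "klein (c t) = (D t / (C * cosh t)) *\<^sub>R c t"
      unfolding klein_def by (simp only:) (simp add: D_def)
    then show ?thesis
      unfolding c_def using D[of t] C(1) by (simp add: scaleR_add_right S_def tanh_def)
  qed
  have "{z \<in> hyp_plane. \<exists>k. klein z = \<delta> *\<^sub>R n + k *\<^sub>R \<tau>} = range c"
  proof (intro equalityI subsetI)
    fix z assume "z \<in> range c"
    then show "z \<in> {z \<in> hyp_plane. \<exists>k. klein z = \<delta> *\<^sub>R n + k *\<^sub>R \<tau>}"
      using hyp klein_c by auto
  next
    fix z assume "z \<in> {z \<in> hyp_plane. \<exists>k. klein z = \<delta> *\<^sub>R n + k *\<^sub>R \<tau>}"
    then obtain k where z: "z \<in> hyp_plane" "klein z = \<delta> *\<^sub>R n + k *\<^sub>R \<tau>" by blast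
    \<comment> \<open>The disc cuts the line exactly where |k| < 1 / C, which is the range of tanh t
      / C.\<close>
    have "\<delta> * \<delta> + k * k < 1" using klein_inner_less_1[OF z(1)] unfolding z(2) lin .
    then have "C * C * (k * k) < C * C * (1 - \<delta> * \<delta>)" using C(1) by (intro mult_strict_left_mono) auto
    then have "(C * k)\<^sup>2 < 1" using C(2) by (simp add: power2_eq_square mult_ac)
    then have "\<bar>C * k\<bar> < 1" by (simp add: abs_square_less_1)
    then obtain t where "tanh t = C * k" using tanh_real_surj by blast
    then have "klein (c t) = klein z" using C(1) by (simp add: klein_c z(2))
    then have "c t = z" using klein_inj_on hyp z(1) by (auto dest: inj_onD)
    then show "z \<in> range c" by blast
  qed
  then show ?thesis
    unfolding complete_hyp_geodesic_def
    using hyp unit deriv deriv2[unfolded geodesic] by (intro exI[of _ c] exI[of _ c']) auto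
qed

lemma complete_hyp_geodesic_klein_line:
  assumes "p \<in> hyp_plane" "klein p \<noteq> q"
  shows "complete_hyp_geodesic {z \<in> hyp_plane. klein z \<in> affine hull {klein p, q}}"
proof -
  define \<tau> where "\<tau> = sgn (q - klein p)"
  \<comment> \<open>Multiplication by i turns the unit direction into a unit normal; \<delta> is
    then the signed distance of the line from the origin, smaller than 1 in absolute value because
    \<open>klein p\<close> lies in the disc.\<close>
  define n where "n = \<i> * \<tau>"
  define \<delta> where "\<delta> = klein p \<bullet> n"
  have "norm \<tau> = 1" using assms(2) by (simp add: \<tau>_def norm_sgn)
  then have \<tau>: "\<tau> \<bullet> \<tau> = 1" by (simp add: norm_eq_1)
  have n: "n \<bullet> n = 1" "n \<bullet> \<tau> = 0" using \<tau> by (simp_all add: n_def inner_complex_def)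
  have decomp: "x = (x \<bullet> n) *\<^sub>R n + (x \<bullet> \<tau>) *\<^sub>R \<tau>" for x
  proof -
    have "(Re \<tau>)\<^sup>2 + (Im \<tau>)\<^sup>2 = 1" using \<tau> by (simp add: inner_complex_def power2_eq_square)
    moreover have "(x \<bullet> n) *\<^sub>R n + (x \<bullet> \<tau>) *\<^sub>R \<tau> = ((Re \<tau>)\<^sup>2 + (Im \<tau>)\<^sup>2) *\<^sub>R x"
      by (simp add: complex_eq_iff n_def inner_complex_def algebra_simps power2_eq_square)
    ultimately show ?thesis by simp
  qed
  have "\<delta> * \<delta> + (klein p \<bullet> \<tau>) * (klein p \<bullet> \<tau>) = klein p \<bullet> klein p"
    using arg_cong[OF decomp[of "klein p"], of "\<lambda>x. klein p \<bullet> x"] by (simp add: inner_simps \<delta>_def)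
  then have "\<delta>\<^sup>2 < 1"
    using klein_inner_less_1[OF assms(1)] zero_le_square[of "klein p \<bullet> \<tau>"]
    unfolding power2_eq_square by linarith
  then have \<delta>: "\<bar>\<delta>\<bar> < 1" by (simp add: abs_square_less_1)
  define r where "r = norm (q - klein p)"
  have r: "r > 0" "q - klein p = r *\<^sub>R \<tau>" using assms(2) by (auto simp: r_def \<tau>_def sgn_div_norm)
  have "x \<in> affine hull {klein p, q} \<longleftrightarrow> (\<exists>k. x = \<delta> *\<^sub>R n + k *\<^sub>R \<tau>)" for x
  proof
    assume "x \<in> affine hull {klein p, q}"
    then obtain u v where uv: "x = u *\<^sub>R klein p + v *\<^sub>R q" "u + v = 1" by (auto simp: affine_hull_2)
    then have "x = klein p + v *\<^sub>R (q - klein p)"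
      by (simp add: algebra_simps flip: scaleR_add_left)
    also have "\<dots> = \<delta> *\<^sub>R n + (klein p \<bullet> \<tau> + v * r) *\<^sub>R \<tau>"
      unfolding r(2) using decomp[of "klein p"] by (simp add: \<delta>_def scaleR_add_left)
    finally show "\<exists>k. x = \<delta> *\<^sub>R n + k *\<^sub>R \<tau>" by blast
  next
    assume "\<exists>k. x = \<delta> *\<^sub>R n + k *\<^sub>R \<tau>"
    then obtain k where "x = \<delta> *\<^sub>R n + k *\<^sub>R \<tau>" by blast
    then have "x = klein p + (k - klein p \<bullet> \<tau>) *\<^sub>R \<tau>"
      using decomp[of "klein p"] by (simp add: \<delta>_def scaleR_diff_left algebra_simps)
    also have "\<dots> = klein p + ((k - klein p \<bullet> \<tau>) / r) *\<^sub>R (q - klein p)"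
      using r by simp
    finally have "x = (1 - (k - klein p \<bullet> \<tau>) / r) *\<^sub>R klein p + ((k - klein p \<bullet> \<tau>) / r) *\<^sub>R q"
      by (simp add: algebra_simps)
    moreover have "(1 - (k - klein p \<bullet> \<tau>) / r) + (k - klein p \<bullet> \<tau>) / r = 1" by simp
    ultimately show "x \<in> affine hull {klein p, q}" unfolding affine_hull_2 by blast
  qed
  then show ?thesis using complete_hyp_geodesic_chord[OF n(1) \<tau> n(2) \<delta>] by simp
qed

lemma connected_complete_hyp_geodesic:
  assumes "complete_hyp_geodesic G"
  shows "connected G"
proof -
  obtain c c' where c: "G = range c" "\<And>t. (c has_vector_derivative c' t) (at t)"
    using assms unfolding complete_hyp_geodesic_def by blast
  then have "continuous_on UNIV c"
    by (meson continuous_at_imp_continuous_on has_vector_derivative_continuous)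
  then show ?thesis using c(1) connected_continuous_image by blast
qed

section \<open>The asymptotic curve\<close>

lemma affine_hull_two_points:
  fixes x y :: complex
  assumes "x \<in> affine hull {p, q}" "y \<in> affine hull {p, q}" "x \<noteq> y"
  shows "affine hull {x, y} = affine hull {p, q}"
proof -
  have "p \<noteq> q" using assms by auto
  moreover have "affine hull {x, y} \<subseteq> affine hull {p, q}"
    using assms by (intro hull_minimal) auto
  ultimately show ?thesis
    using assms(3) by (intro affine_dim_equal) (auto simp: aff_dim_2)
qed

text \<open>The intermediate value theorem applies to the projection onto the chord direction, and
  on the segment this projection determines the point.\<close>

lemma closed_segment_subset_path_image:
  fixes f :: "real \<Rightarrow> 'a::real_inner"
  assumes "l \<le> r" "continuous_on {l..r} f" and seg: "f ` {l..r} \<subseteq> closed_segment (f l) (f r)"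
  shows "closed_segment (f l) (f r) \<subseteq> f ` {l..r}"
proof
  let ?d = "f r - f l"
  fix x assume "x \<in> closed_segment (f l) (f r)"
  then obtain u where u: "x = f l + u *\<^sub>R ?d" "0 \<le> u" "u \<le> 1"
    by (auto simp: in_segment algebra_simps)
  show "x \<in> f ` {l..r}"
  proof (cases "?d = 0")
    case True
    then show ?thesis using u \<open>l \<le> r\<close> by auto
  next
    case False
    define g where "g = (\<lambda>t. (f t - f l) \<bullet> ?d)"
    have "g l = 0" "g r = ?d \<bullet> ?d" by (auto simp: g_def)
    moreover have "0 \<le> u * (?d \<bullet> ?d)" "u * (?d \<bullet> ?d) \<le> ?d \<bullet> ?d"
      using u by (auto intro: mult_nonneg_nonneg mult_left_le_one_le)
    moreover have "continuous_on {l..r} g" unfolding g_def by (intro continuous_intros assms)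
    ultimately obtain t where t: "l \<le> t" "t \<le> r" "g t = u * (?d \<bullet> ?d)"
      using IVT'[of g l "u * (?d \<bullet> ?d)" r] \<open>l \<le> r\<close> by auto
    then have "f t \<in> closed_segment (f l) (f r)" using seg by auto
    then obtain v where v: "f t = f l + v *\<^sub>R ?d" by (auto simp: in_segment algebra_simps)
    have "v = u" using t(3) False by (simp add: g_def v)
    then have "x = f t" using u(1) v by simp
    then show ?thesis using t(1,2) by auto
  qed
qed

context translator_asymptotic_curve
begin

definition klein_curve :: "real \<Rightarrow> complex" where
  "klein_curve i = klein (fst (c i))"

lemma curve_in_hyp_plane: "i \<in> J \<Longrightarrow> fst (c i) \<in> hyp_plane" "i \<in> J \<Longrightarrow> snd (c i) = s"
  using subsetD[OF c_image imageI] by (auto simp: mem_Times_iff)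

text \<open>The last two clauses prepare the passage to the whole curve: distinct values arbitrarily
  near each parameter determine the line, and filling a neighbourhood in the line yields openness in
  the geodesic.\<close>

lemma klein_curve_locally_line:
  assumes "j \<in> J"
  shows "\<exists>V p q. openin Y V \<and> Inr j \<in> V \<and>
    (\<forall>i\<in>J. Inr i \<in> V \<longrightarrow> klein_curve i \<in> affine hull {p, q}) \<and>
    (\<forall>i\<in>J. \<forall>W. openin Y W \<and> Inr i \<in> V \<inter> W \<longrightarrow> (\<exists>i'\<in>J. Inr i' \<in> V \<inter> W \<and> klein_curve i' \<noteq> klein_curve i)) \<and>
    (\<exists>d>0. ball (klein_curve j) d \<inter> affine hull {p, q} \<subseteq> klein_curve ` J)"
proof -
  obtain U \<phi> a e where U: "surface_chart Y (U, \<phi>)" and e: "e > 0"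
    and rect: "{a - e..a + e} \<times> {0..e} \<subseteq> U" and j: "\<phi> (a, 0) = Inr j"
    and bottom: "\<And>t. t \<in> {a - e..a + e} \<Longrightarrow> \<phi> (t, 0) \<in> Inr ` J"
    and upper: "\<And>p. p \<in> {a - e..a + e} \<times> {0<..e} \<Longrightarrow> \<exists>x\<in>topspace X - surface_boundary X. \<phi> p = Inl x"
    and inj: "inj_on (\<lambda>t. F' (\<phi> (t, 0))) {a - e..a + e}"
    by (rule boundary_rectangle[OF assms]) blast
  define I where "I = {a - e..a + e}"
  define \<kappa> where "\<kappa> = (\<lambda>t. klein (fst (F' (\<phi> (t, 0)))))"
  have on_curve: "\<exists>i\<in>J. \<phi> (t, 0) = Inr i \<and> F' (\<phi> (t, 0)) = c i \<and> \<kappa> t = klein_curve i" if "t \<in> I" for t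
    using bottom[of t] that by (auto simp: I_def \<kappa>_def klein_curve_def F'_def)
  have \<kappa>_eq: "\<kappa> t = klein_curve i" if "\<phi> (t, 0) = Inr i" for t i
    using that by (simp add: \<kappa>_def klein_curve_def F'_def)
  have in_hyp: "fst (F' (\<phi> (t, 0))) \<in> hyp_plane" "snd (F' (\<phi> (t, 0))) = s" if "t \<in> I" for t
    using on_curve[OF that] curve_in_hyp_plane by force+
  have inj\<kappa>: "inj_on \<kappa> I"
  proof (rule inj_onI)
    fix t t' assume t: "t \<in> I" "t' \<in> I" "\<kappa> t = \<kappa> t'"
    then have "fst (F' (\<phi> (t, 0))) = fst (F' (\<phi> (t', 0)))"
      using klein_inj_on in_hyp by (auto simp: \<kappa>_def dest: inj_onD)
    then have "F' (\<phi> (t, 0)) = F' (\<phi> (t', 0))" using in_hyp t by (simp add: prod_eq_iff)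
    then show "t = t'" using inj t by (auto simp: I_def dest: inj_onD)
  qed
  have "continuous_on U (F' \<circ> \<phi>)"
    using continuous_map_compose[OF surface_chartD(4)[OF U] F'_continuous] by simp
  moreover have rectI: "(t, 0) \<in> U" if "t \<in> I" for t using rect e that by (auto simp: I_def)
  then have "(\<lambda>t. (t, 0)) ` I \<subseteq> U" by auto
  ultimately have "continuous_on I (\<lambda>t. (F' \<circ> \<phi>) (t, 0))"
    by (rule continuous_on_compose2[OF _ continuous_on_Pair[OF continuous_on_id continuous_on_const]])
  then have "continuous_on I (\<lambda>t. fst (F' (\<phi> (t, 0))))"
    unfolding comp_apply by (rule continuous_on_fst)
  then have cont\<kappa>: "continuous_on I \<kappa>"
    unfolding \<kappa>_def by (rule continuous_on_compose2[OF continuous_on_klein[of UNIV]]) auto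
  \<comment> \<open>Every closed half-plane containing both ends of the arc contains the arc, by
    \<open>arc_comparison\<close>; a line separating a point of the arc from the chord would
    contradict this.\<close>
  have between: "\<kappa> t \<in> closed_segment (\<kappa> (a - e)) (\<kappa> (a + e))" if "t \<in> I" for t
  proof (rule ccontr)
    assume "\<kappa> t \<notin> closed_segment (\<kappa> (a - e)) (\<kappa> (a + e))"
    then obtain v b where sep: "v \<bullet> \<kappa> t < b" "\<forall>x\<in>closed_segment (\<kappa> (a - e)) (\<kappa> (a + e)). b < v \<bullet> x"
      using separating_hyperplane_closed_point[of "closed_segment (\<kappa> (a - e)) (\<kappa> (a + e))" "\<kappa> t"]
      by auto
    have ends: "a - e \<in> I" "a + e \<in> I" using e by (auto simp: I_def)
    have iff: "hyp_linear b (- v) (fst (F' (\<phi> (k, 0)))) \<le> 0 \<longleftrightarrow> b \<le> v \<bullet> \<kappa> k" if "k \<in> I" for k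
      unfolding hyp_linear_le_0_iff[OF in_hyp(1)[OF that]] \<kappa>_def by (simp add: inner_simps)
    have "hyp_linear b (- v) (fst (F' (\<phi> (t, 0)))) \<le> 0"
      by (rule arc_comparison[OF U e rect bottom upper])
        (use sep(2) ends that iff in \<open>auto simp: I_def less_imp_le\<close>)
    then show False using iff[OF that] sep(1) by simp
  qed
  let ?p = "\<kappa> (a - e)" and ?q = "\<kappa> (a + e)"
  have seg: "closed_segment ?p ?q \<subseteq> \<kappa> ` I"
    unfolding I_def by (rule closed_segment_subset_path_image)
      (use e cont\<kappa> between in \<open>auto simp: I_def\<close>)
  \<comment> \<open>A vertical strip of the chart: points of the curve in it lie on the bounding
    line and so have a parameter \<open>t\<close>.\<close>
  define V where "V = \<phi> ` (U \<inter> {a - e<..<a + e} \<times> UNIV)"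
  have openV: "openin Y V"
    unfolding V_def by (rule surface_chart_open_image[OF U])
      (auto intro!: openin_open_Int open_Times)
  have jV: "Inr j \<in> V" unfolding V_def j[symmetric] using rectI[of a] e by (auto simp: I_def)
  have V_param: "\<exists>t\<in>{a - e<..<a + e}. \<phi> (t, 0) = Inr i" if "i \<in> J" "Inr i \<in> V" for i
  proof -
    from that(2)[unfolded V_def] obtain u where "Inr i = \<phi> u" "u \<in> U \<inter> {a - e<..<a + e} \<times> UNIV"
      by (rule imageE)
    then have u: "u \<in> U" "fst u \<in> {a - e<..<a + e}" "\<phi> u = Inr i" by (auto simp: mem_Times_iff)
    then have "(fst u, 0) = u" using chart_point_on_curve[OF U u(1) u(3) that(1)] by (simp add: prod_eq_iff)
    then show ?thesis using u(2,3) by (intro bexI[of _ "fst u"]) simp_all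
  qed
  have on_line: "klein_curve i \<in> affine hull {?p, ?q}" if i: "i \<in> J" "Inr i \<in> V" for i
  proof -
    obtain t where t: "t \<in> {a - e<..<a + e}" "\<phi> (t, 0) = Inr i" using V_param[OF i] by blast
    then have "klein_curve i \<in> closed_segment ?p ?q" using between[of t] \<kappa>_eq by (auto simp: I_def)
    then show ?thesis unfolding segment_convex_hull using convex_hull_subset_affine_hull by blast
  qed
  have two: "\<exists>i'\<in>J. Inr i' \<in> V \<inter> W \<and> klein_curve i' \<noteq> klein_curve i"
    if i: "i \<in> J" "openin Y W" "Inr i \<in> V \<inter> W" for i W
  proof -
    obtain t where t: "t \<in> {a - e<..<a + e}" "\<phi> (t, 0) = Inr i" using V_param[of i] i by blast
    have "continuous_map (top_of_set I) Y (\<lambda>t. \<phi> (t, 0))"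
    proof -
      have "continuous_map (top_of_set I) (top_of_set U) (\<lambda>t. (t, 0))"
        using rectI by (auto intro!: continuous_intros)
      from continuous_map_compose[OF this surface_chartD(4)[OF U]] show ?thesis by (simp add: o_def)
    qed
    from openin_continuous_map_preimage[OF this i(2)]
    have "openin (top_of_set I) {t \<in> I. \<phi> (t, 0) \<in> W}" by simp
    moreover have "t \<in> {t \<in> I. \<phi> (t, 0) \<in> W}" using t i by (auto simp: I_def)
    ultimately obtain d where d: "d > 0" "ball t d \<inter> I \<subseteq> {t \<in> I. \<phi> (t, 0) \<in> W}"
      unfolding openin_contains_ball by blast
    define k where "k = min d (a + e - t)"
    have k: "k > 0" "k \<le> d" "k \<le> a + e - t" using t d(1) by (auto simp: k_def)
    define t' where "t' = t + k / 2"
    have t': "t' \<in> {a - e<..<a + e}" "t' \<in> I" "t' \<in> ball t d" "t' \<noteq> t"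
      using t(1) k by (auto simp: t'_def I_def dist_real_def field_simps)
    obtain i' where i': "i' \<in> J" "\<phi> (t', 0) = Inr i'" using on_curve[OF t'(2)] by blast
    have "Inr i' \<in> V" unfolding V_def i'(2)[symmetric] using t' rectI by blast
    moreover have "Inr i' \<in> W" using d(2) t' i'(2) by force
    moreover have "klein_curve i' \<noteq> klein_curve i"
      using inj_onD[OF inj\<kappa>, of t' t] t' t \<kappa>_eq[OF t(2)] \<kappa>_eq[OF i'(2)] by (auto simp: I_def)
    ultimately show ?thesis using i'(1) by blast
  qed
  have nbhd: "\<exists>d>0. ball (klein_curve j) d \<inter> affine hull {?p, ?q} \<subseteq> klein_curve ` J"
  proof -
    have aI: "a \<in> I" "a - e \<in> I" "a + e \<in> I" using e by (auto simp: I_def)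
    \<comment> \<open>Injectivity keeps the middle point away from the ends, hence in the relative
      interior of a segment that the arc covers.\<close>
    have "\<kappa> a \<noteq> ?p" "\<kappa> a \<noteq> ?q" "?p \<noteq> ?q"
      using inj_onD[OF inj\<kappa> _ aI(1,2)] inj_onD[OF inj\<kappa> _ aI(1,3)] inj_onD[OF inj\<kappa> _ aI(2,3)] e by auto
    then have "klein_curve j \<in> rel_interior (closed_segment ?p ?q)"
      using between[OF aI(1)] \<kappa>_eq[OF j] by (simp add: rel_interior_closed_segment open_segment_def)
    then obtain d where d: "d > 0"
      "ball (klein_curve j) d \<inter> affine hull (closed_segment ?p ?q) \<subseteq> closed_segment ?p ?q"
      unfolding mem_rel_interior_ball by blast
    have hull: "affine hull (closed_segment ?p ?q) = affine hull {?p, ?q}"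
      by (simp add: segment_convex_hull)
    have "\<kappa> ` I \<subseteq> klein_curve ` J" using on_curve by force
    from d(1) order_trans[OF order_trans[OF d(2)[unfolded hull] seg] this]
    show ?thesis by (intro exI[of _ d] conjI)
  qed
  show ?thesis
    by (rule exI[of _ V], rule exI[of _ ?p], rule exI[of _ ?q])
      (intro conjI openV jV nbhd ballI allI impI; (rule on_line | rule two); simp)
qed

text \<open>The line is attached to the parameter and not to the point of the plane, since branches
  of an immersed curve might cross; therefore connectedness is used in \<open>Y\<close>. Once all
  lines agree, the curve is open and closed in a connected geodesic.\<close>

lemma curve_is_geodesic:
  assumes conn: "connectedin Y (Inr ` J)" and "J \<noteq> {}"
    and closed: "closedin (top_of_set hyp_plane) ((\<lambda>i. fst (c i)) ` J)"
  shows "complete_hyp_geodesic ((\<lambda>i. fst (c i)) ` J)"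
proof -
  obtain V p q where V: "\<And>j. j \<in> J \<Longrightarrow> openin Y (V j)" "\<And>j. j \<in> J \<Longrightarrow> Inr j \<in> V j"
    and line: "\<And>j i. j \<in> J \<Longrightarrow> i \<in> J \<Longrightarrow> Inr i \<in> V j \<Longrightarrow> klein_curve i \<in> affine hull {p j, q j}"
    and distinct: "\<And>j i W. j \<in> J \<Longrightarrow> i \<in> J \<Longrightarrow> openin Y W \<Longrightarrow> Inr i \<in> V j \<inter> W \<Longrightarrow>
      \<exists>i'\<in>J. Inr i' \<in> V j \<inter> W \<and> klein_curve i' \<noteq> klein_curve i"
    and nbhd: "\<And>j. j \<in> J \<Longrightarrow> \<exists>d>0. ball (klein_curve j) d \<inter> affine hull {p j, q j} \<subseteq> klein_curve ` J"
  proof -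
    have "\<forall>j. \<exists>V p q. j \<in> J \<longrightarrow> openin Y V \<and> Inr j \<in> V \<and>
      (\<forall>i\<in>J. Inr i \<in> V \<longrightarrow> klein_curve i \<in> affine hull {p, q}) \<and>
      (\<forall>i\<in>J. \<forall>W. openin Y W \<and> Inr i \<in> V \<inter> W \<longrightarrow> (\<exists>i'\<in>J. Inr i' \<in> V \<inter> W \<and> klein_curve i' \<noteq> klein_curve i)) \<and>
      (\<exists>d>0. ball (klein_curve j) d \<inter> affine hull {p, q} \<subseteq> klein_curve ` J)"
      using klein_curve_locally_line by (intro allI) (metis (no_types))
    then obtain V p q where "\<forall>j. j \<in> J \<longrightarrow> openin Y (V j) \<and> Inr j \<in> V j \<and>
      (\<forall>i\<in>J. Inr i \<in> V j \<longrightarrow> klein_curve i \<in> affine hull {p j, q j}) \<and>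
      (\<forall>i\<in>J. \<forall>W. openin Y W \<and> Inr i \<in> V j \<inter> W \<longrightarrow> (\<exists>i'\<in>J. Inr i' \<in> V j \<inter> W \<and> klein_curve i' \<noteq> klein_curve i)) \<and>
      (\<exists>d>0. ball (klein_curve j) d \<inter> affine hull {p j, q j} \<subseteq> klein_curve ` J)"
      unfolding choice_iff by blast
    then show thesis by (intro that[of V p q]) blast+
  qed
  define L where "L = (\<lambda>j. affine hull {p j, q j})"
  have L_eq: "L j = affine hull {x, y}" if "x \<in> L j" "y \<in> L j" "x \<noteq> y" for x y j
    unfolding L_def using that by (intro affine_hull_two_points[symmetric]) (simp_all add: L_def)
  \<comment> \<open>Where two neighbourhoods meet the curve takes two distinct values, and two
    points determine a line.\<close>
  have overlap: "L j = L k" if jk: "j \<in> J" "k \<in> J" "i \<in> J" "Inr i \<in> V j" "Inr i \<in> V k" for i j k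
  proof -
    obtain i' where i': "i' \<in> J" "Inr i' \<in> V j \<inter> V k" "klein_curve i' \<noteq> klein_curve i"
      using distinct[OF jk(1,3) V(1)[OF jk(2)]] jk by blast
    have "klein_curve i' \<in> L j" "klein_curve i \<in> L j" "klein_curve i' \<in> L k" "klein_curve i \<in> L k"
      unfolding L_def using i' jk by (auto intro!: line)
    then show ?thesis using L_eq[OF _ _ i'(3)] by metis
  qed
  obtain j0 where j0: "j0 \<in> J" using \<open>J \<noteq> {}\<close> by blast
  \<comment> \<open>If the line were not constant along the curve, these open sets would disconnect
    it.\<close>
  define E1 E2 where "E1 = \<Union>(V ` {j\<in>J. L j = L j0})" and "E2 = \<Union>(V ` {j\<in>J. L j \<noteq> L j0})"
  have "openin Y E1" "openin Y E2" using V(1) by (auto simp: E1_def E2_def)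
  moreover have "Inr ` J \<subseteq> E1 \<union> E2" using V(2) by (auto simp: E1_def E2_def)
  moreover have "E1 \<inter> E2 \<inter> Inr ` J = {}"
  proof (rule ccontr)
    assume "E1 \<inter> E2 \<inter> Inr ` J \<noteq> {}"
    then obtain i j k where "i \<in> J" "j \<in> J" "L j = L j0" "Inr i \<in> V j" "k \<in> J" "L k \<noteq> L j0" "Inr i \<in> V k"
      unfolding E1_def E2_def by blast
    then show False using overlap[of j k i] by simp
  qed
  moreover have "E1 \<inter> Inr ` J \<noteq> {}" using V(2) j0 by (auto simp: E1_def)
  ultimately have E2: "E2 \<inter> Inr ` J = {}" using conn unfolding connectedin by blast
  have L: "L j = L j0" if "j \<in> J" for j
  proof (rule ccontr)
    assume "L j \<noteq> L j0"
    then have "Inr j \<in> E2 \<inter> Inr ` J" using V(2) that by (auto simp: E2_def)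
    then show False using E2 by blast
  qed
  let ?\<beta> = "(\<lambda>i. fst (c i)) ` J"
  define G where "G = {z \<in> hyp_plane. klein z \<in> L j0}"
  have on_L: "klein_curve i \<in> L j0" if "i \<in> J" for i
    using line[OF that that V(2)[OF that]] L[OF that] by (simp add: L_def)
  obtain i1 where i1: "i1 \<in> J" "klein_curve i1 \<noteq> klein_curve j0"
    using distinct[OF j0 j0 V(1)[OF j0]] V(2)[OF j0] by blast
  have "L j0 = affine hull {klein_curve j0, klein_curve i1}"
    using L_eq[OF on_L[OF j0] on_L[OF i1(1)]] i1 by simp
  then have geo: "complete_hyp_geodesic G"
    unfolding G_def using complete_hyp_geodesic_klein_line[of "fst (c j0)" "klein_curve i1"] i1 j0
      curve_in_hyp_plane(1) by (simp add: klein_curve_def)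
  have sub: "?\<beta> \<subseteq> G" using on_L curve_in_hyp_plane(1) by (auto simp: G_def klein_curve_def)
  \<comment> \<open>The filled neighbourhood in the Klein line is pulled back to \<open>G\<close>,
    using injectivity of \<open>klein\<close>.\<close>
  have "openin (top_of_set G) ?\<beta>"
  proof (subst openin_subopen, intro ballI)
    fix z assume "z \<in> ?\<beta>"
    then obtain j where j: "j \<in> J" "z = fst (c j)" by blast
    obtain d where d: "d > 0" "ball (klein_curve j) d \<inter> L j \<subseteq> klein_curve ` J"
      using nbhd[OF j(1)] by (auto simp: L_def)
    let ?T = "G \<inter> klein -` ball (klein_curve j) d"
    have "openin (top_of_set G) ?T"
      by (rule continuous_openin_preimage_gen[OF continuous_on_klein]) simp
    moreover have "z \<in> ?T" using sub \<open>z \<in> ?\<beta>\<close> d(1) j by (auto simp: klein_curve_def)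
    moreover have "?T \<subseteq> ?\<beta>"
    proof
      fix y assume y: "y \<in> ?T"
      then have "klein y \<in> klein_curve ` J" using d(2) L[OF j(1)] by (auto simp: G_def)
      then obtain i where i: "i \<in> J" "klein y = klein (fst (c i))" by (auto simp: klein_curve_def)
      then have "y = fst (c i)"
        using klein_inj_on curve_in_hyp_plane(1) y by (auto simp: G_def dest: inj_onD)
      then show "y \<in> ?\<beta>" using i by blast
    qed
    ultimately show "\<exists>T. openin (top_of_set G) T \<and> z \<in> T \<and> T \<subseteq> ?\<beta>" by blast
  qed
  moreover have "closedin (top_of_set G) ?\<beta>"
    by (rule closedin_subset_trans[OF closed sub]) (auto simp: G_def)
  ultimately have "?\<beta> = G"
    using connected_complete_hyp_geodesic[OF geo] j0 unfolding connected_clopen by blast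
  then show ?thesis using geo by simp
qed

end

text \<open>In this first countable compactification limits of sequences form the closure, and every
  point of the hyperbolic plane at infinite height already belongs to the boundary at
  infinity.\<close>

lemma closedin_horizontal_asymptotic_boundary:
  assumes "s = \<infinity> \<or> s = -\<infinity>"
  shows "\<exists>C. closed C \<and> horizontal_asymptotic_boundary s A = hyp_plane \<times> {s} \<inter> C"
proof (intro exI conjI)
  show "closed (closure (to_compactification ` A))" by simp
  have "(\<exists>p :: nat \<Rightarrow> complex \<times> real. range p \<subseteq> A \<and> (\<lambda>n. to_compactification (p n)) \<longlonglongrightarrow> x) \<longleftrightarrow>
      x \<in> closure (to_compactification ` A)" for x
  proof
    assume "\<exists>p :: nat \<Rightarrow> complex \<times> real. range p \<subseteq> A \<and> (\<lambda>n. to_compactification (p n)) \<longlonglongrightarrow> x"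
    then obtain p :: "nat \<Rightarrow> complex \<times> real"
      where p: "range p \<subseteq> A" "(\<lambda>n. to_compactification (p n)) \<longlonglongrightarrow> x" by blast
    then show "x \<in> closure (to_compactification ` A)"
      unfolding closure_sequential by (intro exI[of _ "\<lambda>n. to_compactification (p n)"]) auto
  next
    assume "x \<in> closure (to_compactification ` A)"
    then obtain y where y: "\<And>n. y n \<in> to_compactification ` A" "y \<longlonglongrightarrow> x"
      unfolding closure_sequential by blast
    then have "\<forall>n. \<exists>a. a \<in> A \<and> y n = to_compactification a" by blast
    then obtain p where p: "\<forall>n. p n \<in> A \<and> y n = to_compactification (p n)" unfolding choice_iff by blast
    then have "y = (\<lambda>n. to_compactification (p n))" by auto
    then show "\<exists>p :: nat \<Rightarrow> complex \<times> real. range p \<subseteq> A \<and> (\<lambda>n. to_compactification (p n)) \<longlonglongrightarrow> x"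
      using y(2) p by (intro exI[of _ p]) auto
  qed
  then show "horizontal_asymptotic_boundary s A =
      hyp_plane \<times> {s} \<inter> closure (to_compactification ` A)"
    using assms by (auto simp: horizontal_asymptotic_boundary_def asymptotic_boundary_def boundary_at_infinity_def)
qed

theorem corollary14:
  fixes X :: "'a topology" and \<A> :: "'a chart set" and F :: "'a \<Rightarrow> complex \<times> real"
    and s :: ereal and \<C> :: "(complex \<times> ereal) set set" and \<alpha> :: "(complex \<times> ereal) set"
  assumes "translator X \<A> F"
    and "properly_immersed X F"
    and "compactin X (surface_boundary X)"
    and "s = \<infinity> \<or> s = -\<infinity>"
    and "proper_family_of_disjoint_curves s \<C>"
    and "horizontal_asymptotic_boundary s (F ` topspace X) = \<Union>\<C>"
    and "\<alpha> \<in> components (horizontal_asymptotic_boundary s (F ` topspace X))"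
    and "surface_with_asymptotic_curve X F \<alpha>"
  shows "\<exists>G. complete_hyp_geodesic G \<and> \<alpha> = G \<times> {s}"
proof -
  let ?B = "horizontal_asymptotic_boundary s (F ` topspace X)"
  obtain Y :: "('a + real) topology" and J c where Y: "topspace Y = Inl ` topspace X \<union> Inr ` J"
    "continuous_map X Y Inl" "open_map X Y Inl" "Inr ` J \<subseteq> surface_boundary Y" "connectedin Y (Inr ` J)"
    "c ` J = \<alpha>" "\<forall>j\<in>J. \<exists>W. openin Y W \<and> Inr j \<in> W \<and> inj_on c {i\<in>J. Inr i \<in> W}"
    "continuous_map Y (top_of_set (to_compactification ` hyp_product \<union> \<alpha>)) (case_sum (to_compactification \<circ> F) c)"
    using assms(8) unfolding surface_with_asymptotic_curve_def Let_def by blast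
  have \<alpha>: "\<alpha> \<subseteq> ?B" "\<alpha> \<noteq> {}" "closedin (top_of_set ?B) \<alpha>"
    using assms(7) in_components_subset in_components_nonempty closedin_component by blast+
  have B: "?B \<subseteq> hyp_plane \<times> {s}" by (auto simp: horizontal_asymptotic_boundary_def)
  interpret translator_asymptotic_curve X \<A> F s Y J c "case_sum (to_compactification \<circ> F) c"
  proof
    show "continuous_map Y euclidean (case_sum (to_compactification \<circ> F) c)"
      using Y(8) by (simp add: continuous_map_in_subtopology)
    show "continuous_map X (top_of_set hyp_product) F"
      using assms(2) by (simp add: properly_immersed_def)
    show "c ` J \<subseteq> hyp_plane \<times> {s}" using Y(6) \<alpha>(1) B by blast
  qed (use assms Y in auto)
  let ?\<beta> = "(\<lambda>i. fst (c i)) ` J"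
  have \<alpha>\<beta>: "\<alpha> = ?\<beta> \<times> {s}"
  proof -
    have "c ` J = (\<lambda>i. (fst (c i), s)) ` J"
      by (intro image_cong) (simp_all add: prod_eq_iff curve_in_hyp_plane(2))
    then show ?thesis unfolding Y(6) by auto
  qed
  \<comment> \<open>A component is closed in the horizontal boundary, which is itself relatively
    closed at height \<open>s\<close>. This prevents the curve from being a proper subarc of the
    geodesic.\<close>
  have "closedin (top_of_set hyp_plane) ?\<beta>"
  proof -
    obtain C where C: "closed C" "?B = hyp_plane \<times> {s} \<inter> C"
      using closedin_horizontal_asymptotic_boundary[OF assms(4), of "F ` topspace X"] by blast
    obtain C' where C': "closed C'" "\<alpha> = ?B \<inter> C'" using \<alpha>(3) by (auto simp: closedin_closed)
    have "closed ((\<lambda>z. (z, s)) -` (C \<inter> C'))"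
      by (intro continuous_closed_vimage closed_Int C C') (intro continuous_intros)
    moreover have "?\<beta> = hyp_plane \<inter> (\<lambda>z. (z, s)) -` (C \<inter> C')"
      using \<alpha>\<beta> C C' by blast
    ultimately show ?thesis unfolding closedin_closed by blast
  qed
  then have "complete_hyp_geodesic ?\<beta>"
    using curve_is_geodesic[OF Y(5)] \<alpha>(2) Y(6) by blast
  then show ?thesis using \<alpha>\<beta> by blast
qed

end
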